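(* Let $X$ be a complex Banach space, $\alpha>0$, and let $T\in\mathcal{B}(X)$ be such that $\|\Delta^{-\alpha}\mathcal{T}(n)\|\le C\phi(n)$ for $n\in\mathbb{N}_0$, with $\phi\in\omega_{\alpha,loc}$ and $C>0$. Then there exists a bounded algebra homomorphism $\theta:\tau^\alpha(\phi)\to\mathcal{B}(X)$ given by $$\theta(f)x:=\sum_{n=0}^\infty W^\alpha f(n)\,\Delta^{-\alpha}\mathcal{T}(n)x,\qquad x\in X,\ f\in\tau^\alpha(\phi).$$ Furthermore, the following hold. (i) For $n\in\mathbb{N}_0$, $\theta(h_n^\alpha)=\Delta^{-\alpha}\mathcal{T}(n)$; in particular $\theta(e_0)=I$ and $\theta(e_1)=T$. (ii) For $f\in\tau^\alpha(\phi)$ such that $\Delta f\in\tau^\alpha(\phi)$ and $x\in X$, $T\theta(\Delta f)x=(I-T)\theta(f)x-f(0)x$. (iii) In the case that $\sup_{n\in\mathbb{N}_0}\frac{(k^{\beta-\alpha}*\phi)(n)}{\psi(n)}<\infty$, for $0<\alpha<\beta$ and $\psi\in\omega_{\beta,loc}$, then $\tau^\beta(\psi)\hookrightarrow\tau^\alpha(\phi)$ and $$\theta(f)x=\sum_{n=0}^\infty W^\beta f(n)\,\Delta^{-\beta}\mathcal{T}(n)x,\qquad x\in X,\ f\in\tau^\beta(\psi).$$ (iv) If $\|T\|\le a$ for some $a>0$, then $\theta(f)x=\sum_{n=0}^\infty f(n)T^nx$ for $f\in\tau^\alpha(\phi)\cap\ell^1_{a^n}$ and $x\in X$; in particular $\theta(p_\lambda)=(\lambda-T)^{-1}$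 for $|\lambda|>a$.
   Context: $\mathbb{N}_0=\{0,1,2,\dots\}$. $\mathcal{B}(X)$ is the algebra of bounded linear operators on $X$ and $I$ is the identity. $c_{0,0}$ is the space of complex sequences on $\mathbb{N}_0$ with finite support; $e_n(j)=\delta_{n,j}$; convolution is $(f*g)(n)=\sum_{j=0}^nf(n-j)g(j)$. For a positive sequence $\phi$, $\ell^1_\phi$ is the space of complex sequences with $\sum_n\phi(n)|f(n)|<\infty$; $\ell^1_{a^n}$ is the case $\phi(n)=a^n$. The symbol $\hookrightarrow$ means continuous inclusion. For $\alpha>0$, $k^\alpha(n)=\frac{\Gamma(n+\alpha)}{\Gamma(\alpha)\Gamma(n+1)}$. For $T\in\mathcal{B}(X)$ and $\alpha>0$, $\Delta^{-\alpha}\mathcal{T}(n)=\sum_{j=0}^nk^\alpha(n-j)T^j$ (with $T^0=I$). $h_n^\alpha(j)=k^\alpha(n-j)$ for $0\le j\le n$ and $h_n^\alpha(j)=0$ for $j>n$. For $\lambda\in\mathbb{C}\setminus\{0\}$, $p_\lambda(n)=\lambda^{-(n+1)}$. For sequences, $\Delta f(n)=f(n+1)-f(n)$. Weyl sums and differences: for $f\in c_{0,0}$ and $\alpha>0$, $W^{-\alpha}f(n)=\sum_{j=n}^\infty k^\alpha(j-n)f(j)$ and $W^\alpha f=(-1)^m\Delta^mW^{-(m-\alpha)}f$ with $m=[\alpha]+1$. A positive sequence $\phi$ belongs to $\omega_{\alpha,loc}$ if there is $c_\phi>0$ with $$\Big(\sum_{n=0}^j+\sum_{n=p+1}^{j+p}\Big)k^\alpha(n)\phi(j+p-n)\le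 c_\phi\,\phi(j)\phi(p),\qquad 1\le j\le p.$$ For $\phi\in\omega_{\alpha,loc}$, $q_\phi(f)=\sum_{n=0}^\infty\phi(n)|W^\alpha f(n)|$ is a norm on $c_{0,0}$ for which convolution is continuous, and $\tau^\alpha(\phi)$ is the convolution Banach algebra obtained as the completion of $c_{0,0}$ in $q_\phi$ (similarly $\tau^\beta(\psi)$, built with $W^\beta$ and $\psi\in\omega_{\beta,loc}$). The map $W^\alpha$ extends to $\tau^\alpha(\phi)$ with values in $\ell^1_\phi$, and elements $f\in\tau^\alpha(\phi)$ are regarded as sequences via $f(m)=\sum_{n=m}^\infty k^\alpha(n-m)W^\alpha f(n)$.
   Formalization: In (iv), θ(p_λ)=(λ−T)^{-1} is stated for those λ with |λ|>a for which p_λ belongs to τ^α(φ); otherwise θ(p_λ) is undefined (e.g. T=0, φ=k^{α+1}, a=1/2, |λ|=3/4, where p_λ is unbounded). *)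

theory Defs
  imports "HOL-Analysis.Analysis"
begin

text \<open>The norm and the additive structure come from the library class of real Banach spaces;
  the complex scalar multiplication extends the real one, and \<open>norm_scaleC\<close> makes the norm
  a complex norm.\<close>

class complex_banach = banach +
  fixes scaleC :: "complex \<Rightarrow> 'a \<Rightarrow> 'a"  (infixr "*\<^sub>C" 75)
  assumes scaleC_add_right: "c *\<^sub>C (x + y) = c *\<^sub>C x + c *\<^sub>C y"
    and scaleC_add_left: "(c + d) *\<^sub>C x = c *\<^sub>C x + d *\<^sub>C x"
    and scaleC_scaleC: "c *\<^sub>C d *\<^sub>C x = (c * d) *\<^sub>C x"
    and scaleC_of_real: "complex_of_real r *\<^sub>C x = r *\<^sub>R x"
    and norm_scaleC: "norm (c *\<^sub>C x) = norm c * norm x"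

instantiation complex :: complex_banach
begin

definition scaleC_complex :: "complex \<Rightarrow> complex \<Rightarrow> complex"
  where "scaleC_complex c z = c * z"

instance
  by standard (simp_all add: scaleC_complex_def algebra_simps norm_mult scaleR_conv_of_real)

end

definition bounded_clinear :: "('a::complex_banach \<Rightarrow> 'a) \<Rightarrow> bool"
  where "bounded_clinear S \<longleftrightarrow> bounded_linear S \<and> (\<forall>c x. S (c *\<^sub>C x) = c *\<^sub>C S x)"

definition fin_seqs :: "(nat \<Rightarrow> complex) set"
  where "fin_seqs = {f. finite {n. f n \<noteq> 0}}"

definition unit_seq :: "nat \<Rightarrow> nat \<Rightarrow> complex"
  where "unit_seq n j = (if j = n then 1 else 0)"

definition conv :: "(nat \<Rightarrow> 'b::semiring_0) \<Rightarrow> (nat \<Rightarrow> 'b) \<Rightarrow> nat \<Rightarrow> 'b"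
  where "conv f g n = (\<Sum>j=0..n. f (n - j) * g j)"

definition ell1 :: "(nat \<Rightarrow> real) \<Rightarrow> (nat \<Rightarrow> complex) set"
  where "ell1 \<phi> = {f. summable (\<lambda>n. \<phi> n * norm (f n))}"

definition fdiff :: "(nat \<Rightarrow> complex) \<Rightarrow> nat \<Rightarrow> complex"
  where "fdiff f n = f (n + 1) - f n"

definition p_seq :: "complex \<Rightarrow> nat \<Rightarrow> complex"
  where "p_seq z n = 1 / z ^ (n + 1)"

definition cesaro_k :: "real \<Rightarrow> nat \<Rightarrow> real"
  where "cesaro_k \<alpha> n = Gamma (real n + \<alpha>) / (Gamma \<alpha> * Gamma (real n + 1))"

definition cesaro_h :: "real \<Rightarrow> nat \<Rightarrow> nat \<Rightarrow> complex"
  where "cesaro_h \<alpha> n j = (if j \<le> n then complex_of_real (cesaro_k \<alpha> (n - j)) else 0)"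

definition cesaro_sum :: "real \<Rightarrow> ('a::complex_banach \<Rightarrow> 'a) \<Rightarrow> nat \<Rightarrow> 'a \<Rightarrow> 'a"
  where "cesaro_sum \<alpha> T n x = (\<Sum>j=0..n. cesaro_k \<alpha> (n - j) *\<^sub>R (T ^^ j) x)"

text \<open>The sum over \<open>j \<ge> n\<close> of \<open>cesaro_k \<alpha> (j - n) * f j\<close> is written with the index shifted
  by \<open>n\<close>.\<close>

definition weyl_sum :: "real \<Rightarrow> (nat \<Rightarrow> complex) \<Rightarrow> nat \<Rightarrow> complex"
  where "weyl_sum \<alpha> f n = (\<Sum>i. complex_of_real (cesaro_k \<alpha> i) * f (n + i))"

text \<open>This is the Weyl difference on finitely supported sequences; for its extension to the
  completion see \<open>weyl_ext\<close> below.\<close>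

definition weyl_diff :: "real \<Rightarrow> (nat \<Rightarrow> complex) \<Rightarrow> nat \<Rightarrow> complex"
  where "weyl_diff \<alpha> f n =
    (let m = nat \<lfloor>\<alpha>\<rfloor> + 1 in (-1) ^ m * (fdiff ^^ m) (weyl_sum (real m - \<alpha>) f) n)"

definition omega_loc :: "real \<Rightarrow> (nat \<Rightarrow> real) set"
  where "omega_loc \<alpha> = {\<phi>. (\<forall>n. 0 < \<phi> n) \<and>
    (\<exists>c>0. \<forall>j p. 1 \<le> j \<and> j \<le> p \<longrightarrow>
      (\<Sum>n=0..j. cesaro_k \<alpha> n * \<phi> (j + p - n)) + (\<Sum>n=p+1..j+p. cesaro_k \<alpha> n * \<phi> (j + p - n))
        \<le> c * \<phi> j * \<phi> p)}"

text \<open>The completion of \<open>fin_seqs\<close> with respect to the norm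
  \<open>\<Sum>n. \<phi> n * norm (weyl_diff \<alpha> f n)\<close> is realised by sequences. A Cauchy sequence \<open>F\<close> in
  \<open>fin_seqs\<close> has Weyl differences that converge in the (complete) space \<open>ell1 \<phi>\<close> to some
  \<open>g\<close>, which determines the element of the completion. As a sequence, this element is
  \<open>f = weyl_sum \<alpha> g\<close>, and its (extended) Weyl difference is \<open>g\<close>.\<close>

definition tau_rep ::
  "real \<Rightarrow> (nat \<Rightarrow> real) \<Rightarrow> (nat \<Rightarrow> complex) \<Rightarrow> (nat \<Rightarrow> complex) \<Rightarrow> bool"
  where "tau_rep \<alpha> \<phi> f g \<longleftrightarrow>
    g \<in> ell1 \<phi> \<and>
    (\<exists>F. (\<forall>k. F k \<in> fin_seqs) \<and>
      (\<lambda>k. \<Sum>n. \<phi> n * norm (weyl_diff \<alpha> (F k) n - g n)) \<longlonglongrightarrow> 0) \<and>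
    f = weyl_sum \<alpha> g"

definition tau :: "real \<Rightarrow> (nat \<Rightarrow> real) \<Rightarrow> (nat \<Rightarrow> complex) set"
  where "tau \<alpha> \<phi> = {f. \<exists>g. tau_rep \<alpha> \<phi> f g}"

text \<open>For \<open>\<phi> \<in> omega_loc \<alpha>\<close> the sequence \<open>g\<close> is uniquely determined by \<open>f\<close>, because every such
  weight satisfies \<open>\<phi> n \<ge> c * (n + 1) powr \<alpha>\<close> for some \<open>c > 0\<close>, and \<open>weyl_sum \<alpha>\<close> is injective
  on \<open>ell1 \<phi>\<close>.\<close>

definition weyl_ext :: "real \<Rightarrow> (nat \<Rightarrow> real) \<Rightarrow> (nat \<Rightarrow> complex) \<Rightarrow> nat \<Rightarrow> complex"
  where "weyl_ext \<alpha> \<phi> f = (THE g. tau_rep \<alpha> \<phi> f g)"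

definition tau_norm :: "real \<Rightarrow> (nat \<Rightarrow> real) \<Rightarrow> (nat \<Rightarrow> complex) \<Rightarrow> real"
  where "tau_norm \<alpha> \<phi> f = (\<Sum>n. \<phi> n * norm (weyl_ext \<alpha> \<phi> f n))"

text \<open>Bounded homomorphisms from an algebra \<open>A\<close> of sequences under convolution, with norm
  \<open>q\<close>, to the algebra of bounded complex-linear operators under composition. Closure of \<open>A\<close>
  under the operations is included so that both sides of each equation are meaningful.\<close>

definition bounded_algebra_hom ::
  "(nat \<Rightarrow> complex) set \<Rightarrow> ((nat \<Rightarrow> complex) \<Rightarrow> real) \<Rightarrow>
    ((nat \<Rightarrow> complex) \<Rightarrow> 'a::complex_banach \<Rightarrow> 'a) \<Rightarrow> bool"
  where "bounded_algebra_hom A q \<theta> \<longleftrightarrow>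
    (\<forall>f\<in>A. bounded_clinear (\<theta> f)) \<and>
    (\<forall>f\<in>A. \<forall>g\<in>A. (\<lambda>n. f n + g n) \<in> A \<and> \<theta> (\<lambda>n. f n + g n) = (\<lambda>x. \<theta> f x + \<theta> g x)) \<and>
    (\<forall>c. \<forall>f\<in>A. (\<lambda>n. c * f n) \<in> A \<and> \<theta> (\<lambda>n. c * f n) = (\<lambda>x. c *\<^sub>C \<theta> f x)) \<and>
    (\<forall>f\<in>A. \<forall>g\<in>A. conv f g \<in> A \<and> \<theta> (conv f g) = \<theta> f \<circ> \<theta> g) \<and>
    (\<exists>M. \<forall>f\<in>A. onorm (\<theta> f) \<le> M * q f)"

end

theory Submission
  imports Defs
begin

text \<open>Write \<open>binom_k s n = pochhammer s n / n!\<close> for all real \<open>s\<close>; these sequences form a group under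
  convolution. On finitely supported sequences the Weyl difference is therefore inverse to the
  Weyl sum, and since these sequences are dense in \<open>ell1 \<phi>\<close>, the algebra \<open>tau \<alpha> \<phi>\<close> is the
  bijective image of \<open>ell1 \<phi>\<close> under the Weyl sum. Thus every \<open>f\<close> in it is an absolutely
  convergent series \<open>\<Sum>n. g n * cesaro_h \<alpha> n\<close>, and \<open>\<theta>\<close> replaces \<open>cesaro_h \<alpha> n\<close> by
  \<open>cesaro_sum \<alpha> T n\<close>. Both families satisfy \<open>H (n + 1) = binom_k \<alpha> (n + 1) + Z * H n\<close>, with \<open>Z\<close>
  the shift or \<open>T\<close>, and this recursion alone expresses \<open>H j * H p\<close> as a linear combination of
  the \<open>H n\<close>, with the coefficients that appear in the definition of \<open>omega_loc \<alpha>\<close>; so \<open>\<theta>\<close> is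
  multiplicative. The remaining identities are interchanges of absolutely convergent double
  sums, controlled by the lower bound \<open>\<phi> n \<ge> c * binom_k (\<alpha> + 1) n\<close>.\<close>

subsection \<open>Generalised binomial coefficients and triangular sums\<close>

definition binom_k :: "real \<Rightarrow> nat \<Rightarrow> real"
  where "binom_k s n = pochhammer s n / fact n"

lemma cesaro_k_eq: "0 < s \<Longrightarrow> cesaro_k s n = binom_k s n"
proof -
  assume s: "0 < s"
  then have "s \<notin> \<int>\<^sub>\<le>\<^sub>0"
    using nonpos_Ints_nonpos by fastforce
  then have "pochhammer s n = Gamma (s + real n) / Gamma s"
    by (rule pochhammer_Gamma)
  moreover have "Gamma (real n + 1) = fact n"
    using Gamma_fact[of n, where 'a = real] by (simp add: add.commute)
  ultimately show ?thesis
    by (simp add: cesaro_k_def binom_k_def add.commute)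
qed

lemma binom_k_0 [simp]: "binom_k s 0 = 1"
  by (simp add: binom_k_def)

lemma binom_k_zero: "binom_k 0 n = (if n = 0 then 1 else 0)"
  by (simp add: binom_k_def pochhammer_0_left)

lemma binom_k_Suc: "binom_k s (Suc n) = binom_k s n * (s + n) / (n + 1)"
  by (simp add: binom_k_def pochhammer_Suc field_simps)

lemma binom_k_pos: "0 < s \<Longrightarrow> 0 < binom_k s n"
  by (simp add: binom_k_def pochhammer_pos)

lemma binom_k_nonneg: "0 \<le> s \<Longrightarrow> 0 \<le> binom_k s n"
  by (cases "s = 0") (simp_all add: binom_k_zero less_imp_le binom_k_pos)

lemma binom_k_add: "binom_k (s + t) n = (\<Sum>j\<le>n. binom_k s j * binom_k t (n - j))"
proof -
  have "binom_k (s + t) n =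
      (\<Sum>j\<le>n. real (n choose j) * pochhammer s j * pochhammer t (n - j) / fact n)"
    by (simp add: binom_k_def pochhammer_binomial_sum sum_divide_distrib)
  also have "\<dots> = (\<Sum>j\<le>n. binom_k s j * binom_k t (n - j))"
    by (intro sum.cong) (auto simp: binom_k_def binomial_fact)
  finally show ?thesis .
qed

lemma binom_k_plus_1: "binom_k (s + 1) n * s = binom_k s n * (s + n)"
proof (induction n)
  case (Suc n)
  have "binom_k (s + 1) (Suc n) * s = (binom_k (s + 1) n * s) * (s + 1 + n) / (n + 1)"
    by (simp add: binom_k_Suc)
  also have "\<dots> = binom_k s (Suc n) * (s + Suc n)"
    unfolding Suc.IH by (simp add: binom_k_Suc add_ac)
  finally show ?case .
qed simp

lemma binom_k_plus_1_Suc: "binom_k (s + 1) (Suc n) = binom_k (s + 1) n + binom_k s (Suc n)"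
proof -
  have "binom_k (s + 1) (Suc n) = binom_k (s + 1) n + binom_k (s + 1) n * s / (n + 1)"
    by (simp add: binom_k_Suc field_simps)
  then show ?thesis
    by (simp only: binom_k_plus_1 binom_k_Suc)
qed

lemma binom_k_plus_1_sum: "binom_k (s + 1) n = (\<Sum>j\<le>n. binom_k s j)"
  by (induction n) (simp_all add: binom_k_plus_1_Suc)

lemma binom_k_le_plus_1: "0 \<le> s \<Longrightarrow> j \<le> n \<Longrightarrow> binom_k s j \<le> binom_k (s + 1) n"
  unfolding binom_k_plus_1_sum by (intro member_le_sum) (auto intro: binom_k_nonneg)

lemma binom_k_mono: "0 \<le> s \<Longrightarrow> j \<le> n \<Longrightarrow> binom_k (s + 1) j \<le> binom_k (s + 1) n"
  unfolding binom_k_plus_1_sum by (intro sum_mono2) (auto intro: binom_k_nonneg)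

text \<open>From index \<open>s\<close> on, \<open>n * \<bar>binom_k (- s) n\<bar>\<close> decreases with decrement
  \<open>s * \<bar>binom_k (- s) n\<bar>\<close>.\<close>
lemma summable_abs_binom_k_minus:
  assumes "0 < s"
  shows "summable (\<lambda>n. \<bar>binom_k (- s) n\<bar>)"
proof -
  obtain N :: nat where N: "s \<le> N"
    using real_arch_simple by blast
  define d where "d n = real (n + N) * \<bar>binom_k (- s) (n + N)\<bar>" for n
  have step: "d n - d (Suc n) = s * \<bar>binom_k (- s) (n + N)\<bar>" for n
  proof -
    have "\<bar>binom_k (- s) (Suc (n + N))\<bar> = \<bar>binom_k (- s) (n + N)\<bar> * (n + N - s) / (n + N + 1)"
      using N by (simp add: binom_k_Suc abs_mult)
    then have "d (Suc n) = \<bar>binom_k (- s) (n + N)\<bar> * (n + N - s)"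
      by (simp add: d_def)
    then show ?thesis
      by (simp add: d_def algebra_simps)
  qed
  have "0 \<le> s * \<bar>binom_k (- s) (n + N)\<bar>" for n
    using assms by simp
  then have "d (Suc n) \<le> d n" for n
    using step[of n] by (smt (verit))
  then have "decseq d"
    by (simp add: decseq_Suc_iff)
  moreover have "0 \<le> d n" for n
    by (simp add: d_def)
  ultimately obtain L where "d \<longlonglongrightarrow> L"
    using decseq_convergent by blast
  then have "summable (\<lambda>n. s * \<bar>binom_k (- s) (n + N)\<bar>)"
    using telescope_summable'[of d L] step by simp
  then have "summable (\<lambda>n. \<bar>binom_k (- s) (n + N)\<bar>)"
    using assms by (simp add: summable_cmult_iff)
  then show ?thesis
    using summable_iff_shift[of "\<lambda>n. \<bar>binom_k (- s) n\<bar>" N] by simp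
qed

lemma abs_binom_k_conv_le:
  assumes "0 < s"
  obtains B where "0 < B"
    "\<And>l. (\<Sum>n\<le>l. \<bar>binom_k (- s) n\<bar> * binom_k s (l - n)) \<le> B * binom_k (s + 1) l"
proof
  let ?B = "\<Sum>n. \<bar>binom_k (- s) n\<bar>"
  have "1 \<le> (\<Sum>n\<le>0. \<bar>binom_k (- s) n\<bar>)"
    by simp
  also have "\<dots> \<le> ?B"
    by (intro sum_le_suminf summable_abs_binom_k_minus assms) auto
  finally show "0 < ?B"
    by simp
  fix l
  have "(\<Sum>n\<le>l. \<bar>binom_k (- s) n\<bar> * binom_k s (l - n))
      \<le> (\<Sum>n\<le>l. \<bar>binom_k (- s) n\<bar> * binom_k (s + 1) l)"
    using assms by (intro sum_mono mult_left_mono binom_k_le_plus_1) auto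
  also have "\<dots> = (\<Sum>n\<le>l. \<bar>binom_k (- s) n\<bar>) * binom_k (s + 1) l"
    by (simp add: sum_distrib_right)
  also have "\<dots> \<le> ?B * binom_k (s + 1) l"
    using assms
    by (intro mult_right_mono sum_le_suminf summable_abs_binom_k_minus binom_k_nonneg) auto
  finally show "(\<Sum>n\<le>l. \<bar>binom_k (- s) n\<bar> * binom_k s (l - n)) \<le> ?B * binom_k (s + 1) l" .
qed

lemma
  fixes F :: "nat \<Rightarrow> nat \<Rightarrow> 'v::banach"
  assumes "summable (\<lambda>l. \<Sum>n\<le>l. norm (F l n))"
  shows triangle_summable: "summable (\<lambda>i. norm (F (n + i) n))"
    and triangle_sums: "(\<lambda>n. \<Sum>i. F (n + i) n) sums (\<Sum>l. \<Sum>n\<le>l. F l n)"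
    and triangle_summable_norm: "summable (\<lambda>n. \<Sum>i. norm (F (n + i) n))"
proof -
  let ?A = "SIGMA l:(UNIV :: nat set). {..l}"
  have bij: "bij_betw (\<lambda>(n, i). (n + i, n)) (UNIV \<times> UNIV) ?A"
    by (rule bij_betwI[where g = "\<lambda>(l, n). (n, l - n)"]) auto
  have norm_A: "(\<lambda>(l, n). norm (F l n)) summable_on ?A"
    by (rule summable_on_SigmaI[where g = "\<lambda>l. \<Sum>n\<le>l. norm (F l n)"])
      (use assms in \<open>auto intro!: has_sum_finiteI summable_nonneg_imp_summable_on sum_nonneg\<close>)
  then have abs_A: "(\<lambda>(l, n). F l n) abs_summable_on ?A"
    by (simp add: case_prod_unfold)
  have norm_P: "(\<lambda>(n, i). norm (F (n + i) n)) summable_on UNIV \<times> UNIV"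
    using summable_on_reindex_bij_betw[OF bij, of "\<lambda>(l, n). norm (F l n)"] norm_A
    by (simp add: case_prod_unfold)
  have row: "(\<lambda>i. norm (F (n + i) n)) summable_on UNIV" for n
    using summable_on_SigmaD1[OF norm_P] by simp
  then show rows: "summable (\<lambda>i. norm (F (n + i) n))" for n
    using summable_on_imp_summable by blast
  have "(\<lambda>n. \<Sum>\<^sub>\<infinity>i. norm (F (n + i) n)) summable_on UNIV"
    using summable_on_SigmaD[OF norm_P] row by simp
  moreover have "(\<Sum>\<^sub>\<infinity>i. norm (F (n + i) n)) = (\<Sum>i. norm (F (n + i) n))" for n
    using row[of n] by (metis has_sum_imp_sums has_sum_infsum sums_unique)
  ultimately show "summable (\<lambda>n. \<Sum>i. norm (F (n + i) n))"
    using summable_on_imp_summable by simp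
  define S where "S = infsum (\<lambda>(l, n). F l n) ?A"
  have S: "((\<lambda>(l, n). F l n) has_sum S) ?A"
    unfolding S_def using abs_summable_summable[OF abs_A] by simp
  have "((\<lambda>l. \<Sum>n\<le>l. F l n) has_sum S) UNIV"
    by (rule has_sum_SigmaD[OF S]) auto
  then have S1: "S = (\<Sum>l. \<Sum>n\<le>l. F l n)"
    using has_sum_imp_sums sums_unique by blast
  have "((\<lambda>(n, i). F (n + i) n) has_sum S) (UNIV \<times> UNIV)"
    using has_sum_reindex_bij_betw[OF bij, of "\<lambda>(l, n). F l n" S] S
    by (simp add: case_prod_unfold)
  then have "((\<lambda>n. \<Sum>i. F (n + i) n) has_sum S) UNIV"
    using rows
    by (elim has_sum_SigmaD)
      (auto intro!: norm_summable_imp_has_sum summable_sums summable_norm_cancel[OF rows])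
  then show "(\<lambda>n. \<Sum>i. F (n + i) n) sums (\<Sum>l. \<Sum>n\<le>l. F l n)"
    using has_sum_imp_sums S1 by simp
qed

lemma triangle_suminf:
  fixes F :: "nat \<Rightarrow> nat \<Rightarrow> 'v::banach"
  assumes "summable (\<lambda>l. \<Sum>n\<le>l. norm (F l n))"
  shows "(\<Sum>n. \<Sum>i. F (n + i) n) = (\<Sum>l. \<Sum>n\<le>l. F l n)"
  using triangle_sums[OF assms] by (simp add: sums_iff)

subsection \<open>Weyl sums and differences\<close>

lemma sum_binom_k_times: "(\<Sum>i<p. binom_k s i) * s = binom_k s p * p"
proof (induction p)
  case (Suc p)
  have "binom_k s (Suc p) * Suc p = binom_k s p * (s + p)"
    by (simp add: binom_k_Suc)
  then show ?case
    using Suc by (simp add: algebra_simps)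
qed simp

lemma binom_k_quadratic_lower:
  assumes "0 < s" "0 < p"
  shows "s / ((s + 1) * (s + 2)) * (binom_k (s + 1) p)\<^sup>2
    \<le> (\<Sum>i<p. binom_k s (2 * p - i) * binom_k (s + 1) i)"
proof -
  let ?K = "binom_k (s + 1) p"
  have K: "0 < ?K"
    using assms by (simp add: binom_k_pos)
  have far: "s / (2 * p + s) * ?K \<le> binom_k s l" if "p \<le> l" "l \<le> 2 * p" for l
  proof -
    have "?K * s \<le> binom_k (s + 1) l * s"
      using assms that by (intro mult_right_mono binom_k_mono) auto
    also have "\<dots> = binom_k s l * (s + l)"
      by (rule binom_k_plus_1)
    also have "\<dots> \<le> binom_k s l * (2 * p + s)"
      using assms that by (intro mult_left_mono binom_k_nonneg) auto
    finally show ?thesis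
      using assms by (simp add: field_simps)
  qed
  have "s / ((s + 1) * (s + 2)) = s / ((s + 2) * p) * (p / (s + 1))"
    using assms by simp
  also have "\<dots> \<le> s / (2 * p + s) * (p / (s + 1))"
  proof (intro mult_right_mono divide_left_mono)
    show "2 * p + s \<le> (s + 2) * p"
      using assms mult_left_mono[of 1 "real p" s] by (simp add: algebra_simps)
  qed (use assms in \<open>simp_all add: add_pos_pos\<close>)
  finally have "s / ((s + 1) * (s + 2)) * ?K\<^sup>2 \<le> s / (2 * p + s) * (p / (s + 1)) * ?K\<^sup>2"
    by (rule mult_right_mono) simp
  also have "\<dots> = s / (2 * p + s) * ?K * (?K * p / (s + 1))"
    by (simp add: power2_eq_square)
  also have "?K * p / (s + 1) = (\<Sum>i<p. binom_k (s + 1) i)"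
    using assms sum_binom_k_times[of "s + 1" p] by (simp add: field_simps)
  also have "s / (2 * p + s) * ?K * (\<Sum>i<p. binom_k (s + 1) i)
      = (\<Sum>i<p. s / (2 * p + s) * ?K * binom_k (s + 1) i)"
    by (rule sum_distrib_left)
  also have "\<dots> \<le> (\<Sum>i<p. binom_k s (2 * p - i) * binom_k (s + 1) i)"
    using assms by (intro sum_mono mult_right_mono far binom_k_nonneg) auto
  finally show ?thesis .
qed

lemma omega_loc_pos: "\<phi> \<in> omega_loc \<alpha> \<Longrightarrow> 0 < \<phi> n"
  by (simp add: omega_loc_def)

text \<open>Taking \<open>j = p\<close> in the defining inequality bounds \<open>(\<phi> p)\<^sup>2\<close> below by a convolution
  involving only \<open>\<phi> 0, \<dots>, \<phi> (p - 1)\<close>, so a lower bound \<open>m * binom_k (\<alpha> + 1)\<close>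
  propagates by induction once \<open>m\<close> is small.\<close>
lemma omega_loc_lower_bound:
  assumes "0 < \<alpha>" "\<phi> \<in> omega_loc \<alpha>"
  obtains c where "0 < c" "\<And>n. c * binom_k (\<alpha> + 1) n \<le> \<phi> n"
proof -
  have pos: "0 < \<phi> n" for n
    using assms by (simp add: omega_loc_pos)
  obtain c where c: "c > 0" and "\<And>j p. 1 \<le> j \<and> j \<le> p \<Longrightarrow>
      (\<Sum>n=0..j. cesaro_k \<alpha> n * \<phi> (j + p - n)) + (\<Sum>n=p+1..j+p. cesaro_k \<alpha> n * \<phi> (j + p - n))
        \<le> c * \<phi> j * \<phi> p"
    using assms(2) unfolding omega_loc_def by blast
  then have omega: "(\<Sum>n=0..j. binom_k \<alpha> n * \<phi> (j + p - n)) +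
      (\<Sum>n=p+1..j+p. binom_k \<alpha> n * \<phi> (j + p - n)) \<le> c * \<phi> j * \<phi> p"
    if "1 \<le> j" "j \<le> p" for j p
    using that assms(1) by (simp add: cesaro_k_eq)
  define \<delta> where "\<delta> = \<alpha> / ((\<alpha> + 1) * (\<alpha> + 2))"
  have \<delta>: "0 < \<delta>"
    using assms(1) by (simp add: \<delta>_def)
  define m where "m = min (\<phi> 0) (\<delta> / c)"
  have m: "0 < m" "m \<le> \<phi> 0" "c * m \<le> \<delta>"
    using \<delta> c pos[of 0] by (auto simp: m_def min_def field_simps)
  have "m * binom_k (\<alpha> + 1) p \<le> \<phi> p" for p
  proof (induction p rule: less_induct)
    case (less p)
    show ?case
    proof (cases "p = 0")
      case False
      let ?K = "binom_k (\<alpha> + 1) p"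
      have "c * (m * ?K)\<^sup>2 = (c * m) * m * ?K\<^sup>2"
        by (simp add: power2_eq_square)
      also have "\<dots> \<le> \<delta> * m * ?K\<^sup>2"
        using m by (intro mult_right_mono) auto
      also have "\<dots> = m * (\<delta> * ?K\<^sup>2)"
        by simp
      also have "\<dots> \<le> m * (\<Sum>i<p. binom_k \<alpha> (2 * p - i) * binom_k (\<alpha> + 1) i)"
        unfolding \<delta>_def using assms(1) False m
        by (intro mult_left_mono binom_k_quadratic_lower) auto
      also have "\<dots> = (\<Sum>i<p. binom_k \<alpha> (2 * p - i) * (m * binom_k (\<alpha> + 1) i))"
        by (simp add: sum_distrib_left mult_ac)
      also have "\<dots> \<le> (\<Sum>i<p. binom_k \<alpha> (2 * p - i) * \<phi> i)"
        using assms(1) less.IH by (intro sum_mono mult_left_mono binom_k_nonneg) auto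
      also have "\<dots> = (\<Sum>n=p+1..p+p. binom_k \<alpha> n * \<phi> (p + p - n))"
        by (rule sum.reindex_bij_witness[where i = "\<lambda>n. 2 * p - n" and j = "\<lambda>i. 2 * p - i"]) auto
      also have "\<dots> \<le> (\<Sum>n=0..p. binom_k \<alpha> n * \<phi> (p + p - n)) + \<dots>"
        using assms(1) pos by (simp add: sum_nonneg binom_k_nonneg less_imp_le)
      also have "\<dots> \<le> c * (\<phi> p)\<^sup>2"
        using omega[of p p] False by (simp add: power2_eq_square)
      finally have "(m * ?K)\<^sup>2 \<le> (\<phi> p)\<^sup>2"
        using c by simp
      then show ?thesis
        by (rule power2_le_imp_le) (simp add: pos less_imp_le)
    qed (use m in simp)
  qed
  with m(1) show thesis
    by (rule that)
qed

definition weyl_series :: "real \<Rightarrow> (nat \<Rightarrow> complex) \<Rightarrow> nat \<Rightarrow> complex"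
  where "weyl_series s f n = (\<Sum>i. complex_of_real (binom_k s i) * f (n + i))"

lemma weyl_sum_eq: "0 < s \<Longrightarrow> weyl_sum s f = weyl_series s f"
  by (simp add: weyl_sum_def weyl_series_def cesaro_k_eq fun_eq_iff)

lemma suminf_cmult:
  fixes f :: "nat \<Rightarrow> 'b::real_normed_field"
  assumes "summable (\<lambda>n. c * f n)"
  shows "(\<Sum>n. c * f n) = c * (\<Sum>n. f n)"
  using assms by (cases "c = 0") (auto simp: suminf_mult)

lemma weyl_series_compose:
  assumes "summable (\<lambda>l. (\<Sum>j\<le>l. \<bar>binom_k s j\<bar> * \<bar>binom_k t (l - j)\<bar>) * norm (g (n + l)))"
  shows "weyl_series s (weyl_series t g) n = weyl_series (s + t) g n"
proof -
  define F where "F l j = complex_of_real (binom_k s j) * (binom_k t (l - j) * g (n + l))" for l j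
  have summ: "summable (\<lambda>l. \<Sum>j\<le>l. norm (F l j))"
    using assms by (simp add: F_def norm_mult sum_distrib_right mult.assoc)
  have "weyl_series s (weyl_series t g) n = (\<Sum>j. \<Sum>i. F (j + i) j)"
    unfolding weyl_series_def
  proof (rule suminf_cong)
    fix j
    have "summable (\<lambda>i. F (j + i) j)"
      by (rule summable_norm_cancel[OF triangle_summable[OF summ]])
    then show "complex_of_real (binom_k s j) * (\<Sum>i. complex_of_real (binom_k t i) * g (n + j + i))
        = (\<Sum>i. F (j + i) j)"
      unfolding F_def by (subst suminf_cmult) (simp_all add: add.assoc)
  qed
  also have "\<dots> = (\<Sum>l. \<Sum>j\<le>l. F l j)"
    by (rule triangle_suminf[OF summ])
  also have "\<dots> = weyl_series (s + t) g n"
    by (simp add: F_def weyl_series_def binom_k_add sum_distrib_right mult.assoc)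
  finally show ?thesis .
qed

lemma fin_seqsE:
  assumes "f \<in> fin_seqs"
  obtains N where "\<And>n. N \<le> n \<Longrightarrow> f n = 0"
proof -
  obtain N where N: "\<forall>n\<in>{n. f n \<noteq> 0}. n < N"
    using assms finite_nat_set_iff_bounded unfolding fin_seqs_def by blast
  have "f n = 0" if "N \<le> n" for n
    using that N leD by blast
  then show thesis
    using that by blast
qed

lemma fin_seqsI: "(\<And>n. N \<le> n \<Longrightarrow> f n = 0) \<Longrightarrow> f \<in> fin_seqs"
  unfolding fin_seqs_def mem_Collect_eq
  by (rule finite_subset[of _ "{..<N}"]) (use leI in blast)+

lemma summable_fin_seqs:
  fixes c :: "nat \<Rightarrow> 'b::real_normed_field"
  assumes "f \<in> fin_seqs" "\<And>m. f m = 0 \<Longrightarrow> h m = 0"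
  shows "summable (\<lambda>i. c i * h (n + i))"
proof -
  obtain N where "\<And>m. N \<le> m \<Longrightarrow> f m = 0"
    using fin_seqsE[OF assms(1)] by blast
  then show ?thesis
    using assms(2) by (intro summable_finite[of "{..<N}"]) (use leI in auto)
qed

lemma weyl_series_fin_seqs: "g \<in> fin_seqs \<Longrightarrow> weyl_series s g \<in> fin_seqs"
proof -
  assume "g \<in> fin_seqs"
  then obtain N where "\<And>n. N \<le> n \<Longrightarrow> g n = 0"
    using fin_seqsE by blast
  then show "weyl_series s g \<in> fin_seqs"
    by (intro fin_seqsI[of N]) (simp add: weyl_series_def)
qed

lemma fdiff_weyl_series:
  assumes g: "g \<in> fin_seqs"
  shows "fdiff (weyl_series (s + 1) g) n = - weyl_series s g n"
proof -
  have summ: "summable (\<lambda>i. c i * g (n + i))" for c :: "nat \<Rightarrow> complex" and n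
    by (rule summable_fin_seqs[OF g])
  note head = suminf_split_head[OF summ, of _ n, unfolded add_Suc_right, symmetric]
  have "weyl_series (s + 1) g n - weyl_series (s + 1) g (n + 1) =
    g n + ((\<Sum>i. complex_of_real (binom_k (s + 1) (Suc i)) * g (Suc (n + i))) -
      (\<Sum>i. complex_of_real (binom_k (s + 1) i) * g (Suc (n + i))))"
    using head[of "\<lambda>i. complex_of_real (binom_k (s + 1) i)"]
    by (simp add: weyl_series_def diff_eq_eq)
  also have "\<dots> = g n + (\<Sum>i. complex_of_real (binom_k s (Suc i)) * g (Suc (n + i)))"
    using summ[of _ "Suc n"]
    by (subst suminf_diff) (simp_all add: binom_k_plus_1_Suc left_diff_distrib[symmetric]
        flip: of_real_diff)
  also have "\<dots> = weyl_series s g n"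
    using head[of "\<lambda>i. complex_of_real (binom_k s i)"] by (simp add: weyl_series_def diff_eq_eq)
  finally show ?thesis
    by (simp add: fdiff_def) (metis minus_diff_eq)
qed

lemma funpow_fdiff_weyl_series:
  fixes s :: real
  assumes "g \<in> fin_seqs"
  shows "(fdiff ^^ m) (weyl_series (s + m) g) n = (-1) ^ m * weyl_series s g n"
proof (induction m arbitrary: s n)
  case (Suc m s n)
  have "(fdiff ^^ Suc m) (weyl_series (s + Suc m) g) n
      = fdiff ((fdiff ^^ m) (weyl_series ((s + 1) + m) g)) n"
    by (simp add: add_ac)
  also have "\<dots> = (-1) ^ m * fdiff (weyl_series (s + 1) g) n"
    unfolding fdiff_def[of "(fdiff ^^ m) _"] fdiff_def[of "weyl_series _ _"] Suc
    by (simp add: algebra_simps)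
  finally show ?case
    by (simp add: fdiff_weyl_series[OF assms])
qed simp

lemma weyl_series_0: "weyl_series 0 g n = g n"
proof -
  have "weyl_series 0 g n = (\<Sum>i. if i = 0 then g n else 0)"
    unfolding weyl_series_def by (intro suminf_cong) (simp add: binom_k_zero)
  then show ?thesis
    using suminf_finite[of "{0}" "\<lambda>i. if i = 0 then g n else 0"] by simp
qed

lemma weyl_diff_weyl_series:
  assumes "0 < \<alpha>" "g \<in> fin_seqs"
  shows "weyl_diff \<alpha> (weyl_series \<alpha> g) = g"
proof
  fix n
  define m where "m = nat \<lfloor>\<alpha>\<rfloor> + 1"
  have "\<alpha> < m"
    unfolding m_def using assms(1) by linarith
  then have "weyl_sum (m - \<alpha>) (weyl_series \<alpha> g) = weyl_series (m - \<alpha>) (weyl_series \<alpha> g)"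
    by (simp add: weyl_sum_eq)
  also have "\<dots> = weyl_series (0 + real m) g"
    using weyl_series_compose[of "m - \<alpha>" \<alpha> g]
      summable_fin_seqs[OF assms(2), of "\<lambda>m. norm (g m)"] by (auto simp: fun_eq_iff)
  finally have "weyl_diff \<alpha> (weyl_series \<alpha> g) n
      = (-1) ^ m * (fdiff ^^ m) (weyl_series (0 + real m) g) n"
    unfolding weyl_diff_def Let_def m_def by simp
  then show "weyl_diff \<alpha> (weyl_series \<alpha> g) n = g n"
    unfolding funpow_fdiff_weyl_series[OF assms(2)] weyl_series_0
    by (simp flip: mult.assoc power_mult_distrib)
qed

lemma tau_rep_iff:
  assumes "0 < \<alpha>" "\<And>n. 0 \<le> \<phi> n"
  shows "tau_rep \<alpha> \<phi> f g \<longleftrightarrow> g \<in> ell1 \<phi> \<and> f = weyl_series \<alpha> g"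
proof -
  have "\<exists>F. (\<forall>k. F k \<in> fin_seqs) \<and>
      (\<lambda>k. \<Sum>n. \<phi> n * norm (weyl_diff \<alpha> (F k) n - g n)) \<longlonglongrightarrow> 0" if "g \<in> ell1 \<phi>"
  proof -
    define u where "u n = \<phi> n * norm (g n)" for n
    have u: "summable u"
      unfolding u_def using that by (simp add: ell1_def)
    define G where "G k n = (if n < k then g n else 0)" for k n
    have G: "G k \<in> fin_seqs" for k
      by (rule fin_seqsI[of k]) (simp add: G_def)
    have "(\<Sum>n. \<phi> n * norm (weyl_diff \<alpha> (weyl_series \<alpha> (G k)) n - g n)) = (\<Sum>n. u (n + k))" for k
    proof -
      let ?v = "\<lambda>n. \<phi> n * norm (G k n - g n)"
      have shift: "?v (n + k) = u (n + k)" for n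
        by (simp add: G_def u_def)
      have "summable ?v"
        using u summable_iff_shift[of u k] summable_iff_shift[of ?v k] by (simp add: shift)
      then have "suminf ?v = (\<Sum>n. ?v (n + k)) + (\<Sum>n<k. ?v n)"
        by (rule suminf_split_initial_segment)
      also have "(\<Sum>n<k. ?v n) = 0"
        by (intro sum.neutral) (simp add: G_def)
      finally show ?thesis
        using assms(1) G by (simp add: weyl_diff_weyl_series shift)
    qed
    moreover have "(\<lambda>k. \<Sum>n. u (n + k)) \<longlonglongrightarrow> 0"
      using tendsto_diff[OF tendsto_const summable_LIMSEQ[OF u], of "suminf u"]
      by (simp add: suminf_minus_initial_segment[OF u])
    ultimately show ?thesis
      using G by (intro exI[of _ "\<lambda>k. weyl_series \<alpha> (G k)"]) (simp add: weyl_series_fin_seqs)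
  qed
  then show ?thesis
    unfolding tau_rep_def using weyl_sum_eq[OF assms(1)] by auto
qed

lemma ell1_le:
  assumes "f \<in> ell1 \<phi>" "0 < c" "\<And>n. c * \<psi> n \<le> \<phi> n" "\<And>n. 0 \<le> \<psi> n"
  shows "f \<in> ell1 \<psi>"
proof -
  have "summable (\<lambda>n. c * (\<psi> n * norm (f n)))"
  proof (rule summable_comparison_test')
    show "summable (\<lambda>n. \<phi> n * norm (f n))"
      using assms(1) by (simp add: ell1_def)
    show "norm (c * (\<psi> n * norm (f n))) \<le> \<phi> n * norm (f n)" for n
      using assms(2-4) mult_right_mono[of "c * \<psi> n" "\<phi> n" "norm (f n)"]
      by (simp add: abs_mult mult.assoc)
  qed
  then show ?thesis
    using assms(2) by (simp add: ell1_def summable_cmult_iff)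
qed

lemma weyl_series_inverse:
  assumes "0 < \<alpha>" "g \<in> ell1 (binom_k (\<alpha> + 1))"
  shows "weyl_series (- \<alpha>) (weyl_series \<alpha> g) = g"
proof
  fix n
  obtain B where B: "0 < B"
    "\<And>l. (\<Sum>j\<le>l. \<bar>binom_k (- \<alpha>) j\<bar> * binom_k \<alpha> (l - j)) \<le> B * binom_k (\<alpha> + 1) l"
    using abs_binom_k_conv_le[OF assms(1)] by blast
  have "summable (\<lambda>l. B * (binom_k (\<alpha> + 1) (n + l) * norm (g (n + l))))"
    using assms(2) summable_iff_shift[of "\<lambda>l. binom_k (\<alpha> + 1) l * norm (g l)" n]
    by (intro summable_mult) (simp add: ell1_def add.commute)
  then have "summable (\<lambda>l. (\<Sum>j\<le>l. \<bar>binom_k (- \<alpha>) j\<bar> * \<bar>binom_k \<alpha> (l - j)\<bar>) * norm (g (n + l)))"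
  proof (rule summable_comparison_test')
    fix l
    have "(\<Sum>j\<le>l. \<bar>binom_k (- \<alpha>) j\<bar> * \<bar>binom_k \<alpha> (l - j)\<bar>) \<le> B * binom_k (\<alpha> + 1) l"
      using B(2)[of l] assms(1) by (simp add: binom_k_nonneg)
    also have "\<dots> \<le> B * binom_k (\<alpha> + 1) (n + l)"
      using B(1) assms(1) by (intro mult_left_mono binom_k_mono) auto
    finally show "norm ((\<Sum>j\<le>l. \<bar>binom_k (- \<alpha>) j\<bar> * \<bar>binom_k \<alpha> (l - j)\<bar>) * norm (g (n + l)))
        \<le> B * (binom_k (\<alpha> + 1) (n + l) * norm (g (n + l)))"
      by (simp add: abs_mult sum_nonneg mult_right_mono flip: mult.assoc)
  qed
  then show "weyl_series (- \<alpha>) (weyl_series \<alpha> g) n = g n"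
    by (subst weyl_series_compose) (simp_all add: weyl_series_0)
qed

subsection \<open>The product of two Cesaro kernels\<close>

lemma scaleC_one: "1 *\<^sub>C x = (x :: 'a::complex_banach)"
  using scaleC_of_real[of 1 x] by simp

lemma scaleR_conv_scaleC: "r *\<^sub>R x = complex_of_real r *\<^sub>C (x :: 'a::complex_banach)"
  by (simp add: scaleC_of_real)

lemma bounded_bilinear_scaleC:
  "bounded_bilinear (scaleC :: complex \<Rightarrow> 'a \<Rightarrow> 'a::complex_banach)"
  by (rule bounded_bilinear.intro)
    (auto simp: scaleC_add_left scaleC_add_right scaleR_conv_scaleC[where 'a = 'a] scaleC_scaleC norm_scaleC
      scaleR_conv_of_real mult_ac intro!: exI[of _ 1])

interpretation scaleC: bounded_bilinear "scaleC :: complex \<Rightarrow> 'a \<Rightarrow> 'a::complex_banach"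
  by (rule bounded_bilinear_scaleC)

lemma scaleC_left_commute: "c *\<^sub>C d *\<^sub>C x = d *\<^sub>C c *\<^sub>C (x :: 'a::complex_banach)"
  by (simp add: scaleC_scaleC mult.commute)

lemma
  fixes \<Phi> :: "nat \<Rightarrow> 'a::complex_banach"
  assumes "a \<in> ell1 \<phi>" "\<And>n. norm (\<Phi> n) \<le> C * \<phi> n"
  shows ell1_series_sums: "(\<lambda>n. a n *\<^sub>C \<Phi> n) sums (\<Sum>n. a n *\<^sub>C \<Phi> n)"
    and ell1_series_norm_le: "norm (\<Sum>n. a n *\<^sub>C \<Phi> n) \<le> C * (\<Sum>n. \<phi> n * norm (a n))"
proof -
  have a: "summable (\<lambda>n. C * (\<phi> n * norm (a n)))"
    using assms(1) by (intro summable_mult) (simp add: ell1_def)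
  have le: "norm (a n *\<^sub>C \<Phi> n) \<le> C * (\<phi> n * norm (a n))" for n
    using mult_left_mono[OF assms(2)[of n], of "norm (a n)"] by (simp add: norm_scaleC mult_ac)
  have summ: "summable (\<lambda>n. norm (a n *\<^sub>C \<Phi> n))"
    by (rule summable_comparison_test'[OF a]) (simp add: le)
  then show "(\<lambda>n. a n *\<^sub>C \<Phi> n) sums (\<Sum>n. a n *\<^sub>C \<Phi> n)"
    by (rule summable_sums[OF summable_norm_cancel])
  have "norm (\<Sum>n. a n *\<^sub>C \<Phi> n) \<le> (\<Sum>n. norm (a n *\<^sub>C \<Phi> n))"
    by (rule summable_norm[OF summ])
  also have "\<dots> \<le> (\<Sum>n. C * (\<phi> n * norm (a n)))"
    by (intro suminf_le summ a le)
  also have "\<dots> = C * (\<Sum>n. \<phi> n * norm (a n))"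
    using assms(1) by (intro suminf_mult) (simp add: ell1_def)
  finally show "norm (\<Sum>n. a n *\<^sub>C \<Phi> n) \<le> C * (\<Sum>n. \<phi> n * norm (a n))" .
qed

lemma ell1_add:
  assumes "f \<in> ell1 \<phi>" "g \<in> ell1 \<phi>" "\<And>n. 0 \<le> \<phi> n"
  shows "(\<lambda>n. f n + g n) \<in> ell1 \<phi>"
proof -
  have "summable (\<lambda>n. \<phi> n * norm (f n) + \<phi> n * norm (g n))"
    using assms by (intro summable_add) (simp_all add: ell1_def)
  then show ?thesis
    unfolding ell1_def mem_Collect_eq
    by (rule summable_comparison_test')
      (use assms(3) in \<open>auto simp: abs_mult intro!: mult_left_mono norm_triangle_ineq
        simp flip: distrib_left\<close>)
qed

lemma ell1_cmult: "f \<in> ell1 \<phi> \<Longrightarrow> (\<lambda>n. c * f n) \<in> ell1 \<phi>"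
  using summable_mult[of "\<lambda>n. \<phi> n * norm (f n)" "norm c"] by (simp add: ell1_def norm_mult mult_ac)

lemma ell1_unit_seq: "unit_seq n \<in> ell1 \<phi>"
  unfolding ell1_def mem_Collect_eq by (rule summable_finite[of "{n}"]) (auto simp: unit_seq_def)

text \<open>The coefficient of \<open>cesaro_h \<alpha> n\<close> in the product of \<open>cesaro_h \<alpha> j\<close> and
  \<open>cesaro_h \<alpha> p\<close>. With generating functions, it comes from
  \<open>(u - v) / ((1 - z * u) * (1 - z * v)) = u / (1 - z * u) - v / (1 - z * v)\<close>.\<close>
definition prod_coeff :: "real \<Rightarrow> nat \<Rightarrow> nat \<Rightarrow> nat \<Rightarrow> real"
  where "prod_coeff \<alpha> j p n =
    (if n \<le> j + p then (1 - of_bool (n < p) - of_bool (n < j)) * binom_k \<alpha> (j + p - n) else 0)"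

lemma prod_coeff_commute: "prod_coeff \<alpha> j p n = prod_coeff \<alpha> p j n"
  by (simp add: prod_coeff_def add.commute)

lemma prod_coeff_expansion:
  fixes H :: "nat \<Rightarrow> 'v::real_vector"
  assumes "\<And>p. L 0 p = H p"
    and "\<And>j p. L (Suc j) p = L j (Suc p) + binom_k \<alpha> (Suc j) *\<^sub>R H p - binom_k \<alpha> (Suc p) *\<^sub>R H j"
  shows "L j p = (\<Sum>n\<le>j + p. prod_coeff \<alpha> j p n *\<^sub>R H n)"
proof (induction j arbitrary: p)
  case 0
  have "(\<Sum>n\<le>p. prod_coeff \<alpha> 0 p n *\<^sub>R H n) = (\<Sum>n\<le>p. if n = p then H p else 0)"
    by (intro sum.cong) (auto simp: prod_coeff_def)
  then show ?case
    using assms(1) by simp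
next
  case (Suc j)
  have "prod_coeff \<alpha> (Suc j) p n *\<^sub>R H n = prod_coeff \<alpha> j (Suc p) n *\<^sub>R H n
      + (if n = p then binom_k \<alpha> (Suc j) *\<^sub>R H p else 0)
      - (if n = j then binom_k \<alpha> (Suc p) *\<^sub>R H j else 0)" for n
    by (auto simp: prod_coeff_def Suc_diff_le less_Suc_eq not_le)
  then have "(\<Sum>n\<le>Suc j + p. prod_coeff \<alpha> (Suc j) p n *\<^sub>R H n)
      = (\<Sum>n\<le>j + Suc p. prod_coeff \<alpha> j (Suc p) n *\<^sub>R H n)
      + binom_k \<alpha> (Suc j) *\<^sub>R H p - binom_k \<alpha> (Suc p) *\<^sub>R H j"
    by (simp add: sum.distrib sum_subtractf)
  then show ?case
    using assms(2) Suc by simp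
qed

lemma prod_coeff_bound:
  assumes "0 < \<alpha>" "\<phi> \<in> omega_loc \<alpha>"
  obtains M where "\<And>j p. (\<Sum>n\<le>j + p. \<bar>prod_coeff \<alpha> j p n\<bar> * \<phi> n) \<le> M * (\<phi> j * \<phi> p)"
proof -
  have pos: "0 < \<phi> n" for n
    using assms by (simp add: omega_loc_pos)
  obtain c where c: "c > 0" and "\<And>j p. 1 \<le> j \<and> j \<le> p \<Longrightarrow>
      (\<Sum>n=0..j. cesaro_k \<alpha> n * \<phi> (j + p - n)) + (\<Sum>n=p+1..j+p. cesaro_k \<alpha> n * \<phi> (j + p - n))
        \<le> c * \<phi> j * \<phi> p"
    using assms(2) unfolding omega_loc_def by blast
  then have omega: "(\<Sum>n=0..j. binom_k \<alpha> n * \<phi> (j + p - n)) +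
      (\<Sum>n=p+1..j+p. binom_k \<alpha> n * \<phi> (j + p - n)) \<le> c * \<phi> j * \<phi> p"
    if "1 \<le> j" "j \<le> p" for j p
    using that assms(1) by (simp add: cesaro_k_eq)
  let ?S = "\<lambda>j p. \<Sum>n\<le>j + p. \<bar>prod_coeff \<alpha> j p n\<bar> * \<phi> n"
  define M where "M = max c (1 / \<phi> 0)"
  have le: "?S j p \<le> M * (\<phi> j * \<phi> p)" if "j \<le> p" for j p
  proof (cases "j = 0")
    case True
    have "?S 0 p = (\<Sum>n\<le>p. if n = p then \<phi> p else 0)"
      by (intro sum.cong) (auto simp: prod_coeff_def)
    also have "\<dots> = 1 / \<phi> 0 * (\<phi> 0 * \<phi> p)"
      using pos[of 0] by simp
    also have "\<dots> \<le> M * (\<phi> 0 * \<phi> p)"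
      using pos by (intro mult_right_mono) (auto simp: M_def less_imp_le)
    finally show ?thesis
      using True by simp
  next
    case False
    have "?S j p = (\<Sum>n\<in>{p..j + p} \<union> {..<j}. \<bar>prod_coeff \<alpha> j p n\<bar> * \<phi> n)"
      using that by (intro sum.mono_neutral_right) (auto simp: prod_coeff_def)
    also have "\<dots> = (\<Sum>n\<in>{p..j + p}. \<bar>prod_coeff \<alpha> j p n\<bar> * \<phi> n)
        + (\<Sum>n<j. \<bar>prod_coeff \<alpha> j p n\<bar> * \<phi> n)"
      using that by (intro sum.union_disjoint) auto
    also have "(\<Sum>n\<in>{p..j + p}. \<bar>prod_coeff \<alpha> j p n\<bar> * \<phi> n)
        = (\<Sum>n=0..j. binom_k \<alpha> n * \<phi> (j + p - n))"
      using that assms(1)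
      by (intro sum.reindex_bij_witness[where i = "\<lambda>n. j + p - n" and j = "\<lambda>n. j + p - n"])
        (auto simp: prod_coeff_def abs_mult binom_k_nonneg)
    also have "(\<Sum>n<j. \<bar>prod_coeff \<alpha> j p n\<bar> * \<phi> n)
        = (\<Sum>n=p+1..j+p. binom_k \<alpha> n * \<phi> (j + p - n))"
      using that assms(1)
      by (intro sum.reindex_bij_witness[where i = "\<lambda>n. j + p - n" and j = "\<lambda>n. j + p - n"])
        (auto simp: prod_coeff_def abs_mult binom_k_nonneg)
    also have "(\<Sum>n=0..j. binom_k \<alpha> n * \<phi> (j + p - n)) +
        (\<Sum>n=p+1..j+p. binom_k \<alpha> n * \<phi> (j + p - n)) \<le> c * (\<phi> j * \<phi> p)"
      using omega[of j p] that False by (simp add: mult.assoc)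
    also have "\<dots> \<le> M * (\<phi> j * \<phi> p)"
      using pos by (intro mult_right_mono) (auto simp: M_def less_imp_le)
    finally show ?thesis .
  qed
  have "?S j p \<le> M * (\<phi> j * \<phi> p)" for j p
  proof (cases "j \<le> p")
    case False
    then have "?S p j \<le> M * (\<phi> p * \<phi> j)"
      by (intro le) simp
    then show ?thesis
      by (simp add: prod_coeff_commute[of \<alpha> p] add.commute mult.commute[of "\<phi> p"])
  qed (rule le)
  then show thesis
    by (rule that)
qed

definition weyl_prod :: "real \<Rightarrow> (nat \<Rightarrow> complex) \<Rightarrow> (nat \<Rightarrow> complex) \<Rightarrow> nat \<Rightarrow> complex"
  where "weyl_prod \<alpha> a b n =
    (\<Sum>\<^sub>\<infinity>(j, p)\<in>UNIV \<times> UNIV. a j * b p * complex_of_real (prod_coeff \<alpha> j p n))"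

lemma
  assumes "0 < \<alpha>" "\<phi> \<in> omega_loc \<alpha>" "a \<in> ell1 \<phi>" "b \<in> ell1 \<phi>"
  shows weyl_prod_ell1: "weyl_prod \<alpha> a b \<in> ell1 \<phi>"
    and weyl_prod_sums:
      "\<And>(H :: nat \<Rightarrow> 'v::complex_banach) L Y Z C. (\<And>n. norm (H n) \<le> C * \<phi> n) \<Longrightarrow>
        (\<And>j p. L j p = (\<Sum>n\<le>j + p. prod_coeff \<alpha> j p n *\<^sub>R H n)) \<Longrightarrow>
        (\<And>j. (\<lambda>p. b p *\<^sub>C L j p) sums Y j) \<Longrightarrow> (\<lambda>j. a j *\<^sub>C Y j) sums Z \<Longrightarrow>
        (\<lambda>n. weyl_prod \<alpha> a b n *\<^sub>C H n) sums Z"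
proof -
  have pos: "0 < \<phi> n" for n
    using assms by (simp add: omega_loc_pos)
  obtain M where M: "\<And>j p. (\<Sum>n\<le>j + p. \<bar>prod_coeff \<alpha> j p n\<bar> * \<phi> n) \<le> M * (\<phi> j * \<phi> p)"
    using prod_coeff_bound[OF assms(1,2)] by blast
  have u: "(\<lambda>n. \<phi> n * norm (f n)) summable_on UNIV" if "f \<in> ell1 \<phi>" for f
    using that pos by (intro summable_nonneg_imp_summable_on) (auto simp: ell1_def less_imp_le)
  define w where "w q n = (case q of (j, p) \<Rightarrow> a j * b p * complex_of_real (prod_coeff \<alpha> j p n))"
    for q n
  have "(\<lambda>(j, p). (\<phi> j * norm (a j)) * (\<phi> p * norm (b p))) summable_on UNIV \<times> UNIV"
    by (rule summable_on_SigmaI[where g = "\<lambda>j. (\<phi> j * norm (a j)) * (\<Sum>\<^sub>\<infinity>p. \<phi> p * norm (b p))"])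
      (use u assms(3,4) pos in \<open>auto intro!: has_sum_cmult_right summable_on_cmult_left
        simp: less_imp_le\<close>)
  then have ab: "(\<lambda>(j, p). M * ((\<phi> j * norm (a j)) * (\<phi> p * norm (b p)))) summable_on UNIV \<times> UNIV"
    using summable_on_cmult_right by (fastforce simp: case_prod_unfold)
  have row: "(\<lambda>(j, p). norm (a j) * norm (b p) * (\<Sum>n\<le>j + p. \<bar>prod_coeff \<alpha> j p n\<bar> * \<phi> n))
      summable_on UNIV"
  proof (rule summable_on_comparison_test)
    show "(\<lambda>(j, p). M * ((\<phi> j * norm (a j)) * (\<phi> p * norm (b p)))) summable_on UNIV"
      using ab by simp
    fix q :: "nat \<times> nat"
    obtain j p where q: "q = (j, p)"
      by force
    show "(case q of (j, p) \<Rightarrow> norm (a j) * norm (b p) *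
        (\<Sum>n\<le>j + p. \<bar>prod_coeff \<alpha> j p n\<bar> * \<phi> n))
      \<le> (case q of (j, p) \<Rightarrow> M * ((\<phi> j * norm (a j)) * (\<phi> p * norm (b p))))"
      using mult_left_mono[OF M[of j p], of "norm (a j) * norm (b p)"] by (simp add: q mult_ac)
    show "0 \<le> (case q of (j, p) \<Rightarrow> norm (a j) * norm (b p) *
        (\<Sum>n\<le>j + p. \<bar>prod_coeff \<alpha> j p n\<bar> * \<phi> n))"
      using pos by (auto simp: q less_imp_le intro!: mult_nonneg_nonneg sum_nonneg)
  qed
  have w: "(\<lambda>(q, n). norm (w q n) * \<phi> n) summable_on UNIV \<times> UNIV"
  proof (rule summable_on_SigmaI)
    fix q :: "nat \<times> nat"
    obtain j p where q: "q = (j, p)"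
      by force
    show "((\<lambda>n. case (q, n) of (q, n) \<Rightarrow> norm (w q n) * \<phi> n) has_sum
        (case q of (j, p) \<Rightarrow> norm (a j) * norm (b p) * (\<Sum>n\<le>j + p. \<bar>prod_coeff \<alpha> j p n\<bar> * \<phi> n))) UNIV"
      by (rule has_sum_finite_neutralI[of "{..j + p}"])
        (auto simp: q w_def norm_mult prod_coeff_def sum_distrib_left mult_ac)
  next
    show "(\<lambda>(j, p). norm (a j) * norm (b p) * (\<Sum>n\<le>j + p. \<bar>prod_coeff \<alpha> j p n\<bar> * \<phi> n))
        summable_on UNIV"
      by (rule row)
  qed (use pos in \<open>auto simp: less_imp_le\<close>)
  then have w': "(\<lambda>(n, q). norm (w q n) * \<phi> n) summable_on UNIV \<times> UNIV"
    using summable_on_swap[of "\<lambda>(q, n). norm (w q n) * \<phi> n" UNIV UNIV] by simp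
  have col: "(\<lambda>q. norm (w q n)) summable_on UNIV" for n
  proof -
    have "(\<lambda>q. norm (w q n) * \<phi> n) summable_on UNIV"
      using summable_on_SigmaD1[OF w'] by simp
    then show ?thesis
      using summable_on_cmult_left'[of "\<phi> n" "\<lambda>q. norm (w q n)" UNIV] pos[of n] by simp
  qed
  have prod_eq: "weyl_prod \<alpha> a b n = (\<Sum>\<^sub>\<infinity>q. w q n)" for n
    by (simp add: weyl_prod_def w_def)
  have "(\<lambda>n. \<Sum>\<^sub>\<infinity>q. norm (w q n) * \<phi> n) summable_on UNIV"
    using summable_on_SigmaD[OF w'] summable_on_SigmaD1[OF w'] by simp
  then have "summable (\<lambda>n. \<Sum>\<^sub>\<infinity>q. norm (w q n) * \<phi> n)"
    by (rule summable_on_imp_summable)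
  then show "weyl_prod \<alpha> a b \<in> ell1 \<phi>"
    unfolding ell1_def mem_Collect_eq
  proof (rule summable_comparison_test')
    fix n
    have "norm (weyl_prod \<alpha> a b n) \<le> (\<Sum>\<^sub>\<infinity>q. norm (w q n))"
      unfolding prod_eq by (intro norm_infsum_bound col)
    then show "norm (\<phi> n * norm (weyl_prod \<alpha> a b n)) \<le> (\<Sum>\<^sub>\<infinity>q. norm (w q n) * \<phi> n)"
      using pos[of n] col by (simp add: infsum_cmult_left abs_mult)
  qed
  fix H :: "nat \<Rightarrow> 'v" and L Y Z C
  assume H: "\<And>n. norm (H n) \<le> C * \<phi> n"
    and L: "\<And>j p. L j p = (\<Sum>n\<le>j + p. prod_coeff \<alpha> j p n *\<^sub>R H n)"
    and Y: "\<And>j. (\<lambda>p. b p *\<^sub>C L j p) sums Y j" and Z: "(\<lambda>j. a j *\<^sub>C Y j) sums Z"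
  have "(\<lambda>(q, n). C * (norm (w q n) * \<phi> n)) summable_on UNIV \<times> UNIV"
    using summable_on_cmult_right[OF w, of C] by (simp add: case_prod_unfold)
  then have "(\<lambda>(q, n). w q n *\<^sub>C H n) abs_summable_on UNIV \<times> UNIV"
  proof (rule Infinite_Sum.abs_summable_on_comparison_test')
    fix x :: "(nat \<times> nat) \<times> nat"
    show "norm (case x of (q, n) \<Rightarrow> w q n *\<^sub>C H n)
        \<le> (case x of (q, n) \<Rightarrow> C * (norm (w q n) * \<phi> n))"
      using mult_left_mono[OF H[of "snd x"], of "norm (w (fst x) (snd x))"]
      by (simp add: case_prod_unfold norm_scaleC mult_ac)
  qed
  then have "(\<lambda>(q, n). w q n *\<^sub>C H n) summable_on UNIV \<times> UNIV"
    by (rule abs_summable_summable)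
  then obtain S where S: "((\<lambda>(q, n). w q n *\<^sub>C H n) has_sum S) (UNIV \<times> UNIV)"
    using summable_on_def by blast
  then have "((\<lambda>(n, q). w q n *\<^sub>C H n) has_sum S) (UNIV \<times> UNIV)"
    using has_sum_swap[where f = "\<lambda>(q, n). w q n *\<^sub>C H n" and S = S and A = UNIV and B = UNIV] by simp
  then have "((\<lambda>n. weyl_prod \<alpha> a b n *\<^sub>C H n) has_sum S) UNIV"
  proof (rule has_sum_SigmaD)
    fix n
    have "((\<lambda>q. w q n) has_sum weyl_prod \<alpha> a b n) UNIV"
      unfolding prod_eq by (rule has_sum_infsum[OF abs_summable_summable[OF col]])
    then show "((\<lambda>q. case (n, q) of (n, q) \<Rightarrow> w q n *\<^sub>C H n) has_sum weyl_prod \<alpha> a b n *\<^sub>C H n) UNIV"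
      using has_sum_bounded_linear[OF scaleC.bounded_linear_left] by fastforce
  qed
  then have sums_S: "(\<lambda>n. weyl_prod \<alpha> a b n *\<^sub>C H n) sums S"
    by (rule has_sum_imp_sums)
  have "((\<lambda>(j, p). (a j * b p) *\<^sub>C L j p) has_sum S) UNIV"
  proof (rule has_sum_SigmaD[OF S])
    fix q :: "nat \<times> nat"
    obtain j p where q: "q = (j, p)"
      by force
    have "(a j * b p) *\<^sub>C L j p = (\<Sum>n\<le>j + p. w q n *\<^sub>C H n)"
      by (simp add: L q w_def scaleC.sum_right scaleR_conv_scaleC scaleC_scaleC)
    then show "((\<lambda>n. case (q, n) of (q, n) \<Rightarrow> w q n *\<^sub>C H n) has_sum
        (case q of (j, p) \<Rightarrow> (a j * b p) *\<^sub>C L j p)) UNIV"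
      by (intro has_sum_finite_neutralI[of "{..j + p}"])
        (auto simp: q w_def prod_coeff_def scaleC.zero_left)
  qed
  then have LS: "((\<lambda>(j, p). (a j * b p) *\<^sub>C L j p) has_sum S) (UNIV \<times> UNIV)"
    by simp
  have "(\<lambda>(j, p). C * (norm (a j) * norm (b p) * (\<Sum>n\<le>j + p. \<bar>prod_coeff \<alpha> j p n\<bar> * \<phi> n)))
      summable_on UNIV"
    using summable_on_cmult_right[OF row, of C] by (simp add: case_prod_unfold)
  then have "(\<lambda>(j, p). (a j * b p) *\<^sub>C L j p) abs_summable_on UNIV"
  proof (rule Infinite_Sum.abs_summable_on_comparison_test')
    fix q :: "nat \<times> nat"
    obtain j p where q: "q = (j, p)"
      by force
    have "norm (L j p) \<le> (\<Sum>n\<le>j + p. \<bar>prod_coeff \<alpha> j p n\<bar> * (C * \<phi> n))"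
      unfolding L by (intro sum_norm_le) (simp add: H mult_left_mono)
    also have "\<dots> = C * (\<Sum>n\<le>j + p. \<bar>prod_coeff \<alpha> j p n\<bar> * \<phi> n)"
      by (simp add: sum_distrib_left mult_ac)
    finally have "norm (L j p) \<le> C * (\<Sum>n\<le>j + p. \<bar>prod_coeff \<alpha> j p n\<bar> * \<phi> n)" .
    from mult_left_mono[OF this, of "norm (a j * b p)"]
    show "norm (case q of (j, p) \<Rightarrow> (a j * b p) *\<^sub>C L j p) \<le> (case q of (j, p) \<Rightarrow>
        C * (norm (a j) * norm (b p) * (\<Sum>n\<le>j + p. \<bar>prod_coeff \<alpha> j p n\<bar> * \<phi> n)))"
      by (simp add: q norm_scaleC norm_mult mult_ac)
  qed
  then have LN: "(\<lambda>(j, p). norm ((a j * b p) *\<^sub>C L j p)) summable_on UNIV \<times> UNIV"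
    by (simp add: case_prod_unfold)
  from LS have "((\<lambda>j. a j *\<^sub>C Y j) has_sum S) UNIV"
  proof (rule has_sum_SigmaD)
    fix j
    have "(\<lambda>p. (a j * b p) *\<^sub>C L j p) summable_on UNIV"
      by (rule abs_summable_summable) (use summable_on_SigmaD1[OF LN] in simp)
    then obtain y where y: "((\<lambda>p. (a j * b p) *\<^sub>C L j p) has_sum y) UNIV"
      using summable_on_def by blast
    moreover have "(\<lambda>p. (a j * b p) *\<^sub>C L j p) sums (a j *\<^sub>C Y j)"
      using scaleC.bounded_linear_right[THEN bounded_linear.sums, OF Y]
      by (simp add: scaleC_scaleC)
    ultimately have "y = a j *\<^sub>C Y j"
      using has_sum_imp_sums sums_unique2 by blast
    with y show "((\<lambda>p. case (j, p) of (j, p) \<Rightarrow> (a j * b p) *\<^sub>C L j p) has_sum a j *\<^sub>C Y j) UNIV"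
      by simp
  qed
  then have "S = Z"
    using Z has_sum_imp_sums sums_unique2 by blast
  with sums_S show "(\<lambda>n. weyl_prod \<alpha> a b n *\<^sub>C H n) sums Z"
    by simp
qed

subsection \<open>The algebra as an image of a weighted summable space\<close>

lemma weyl_series_summable:
  assumes "0 < s" "a \<in> ell1 (binom_k (s + 1))"
  shows "summable (\<lambda>i. norm (complex_of_real (binom_k s i) * a (n + i)))"
proof -
  have "summable (\<lambda>i. binom_k (s + 1) (n + i) * norm (a (n + i)))"
    using assms(2) summable_iff_shift[of "\<lambda>i. binom_k (s + 1) i * norm (a i)" n]
    by (simp add: ell1_def add.commute)
  then show ?thesis
  proof (rule summable_comparison_test')
    fix i
    show "norm (norm (complex_of_real (binom_k s i) * a (n + i)))
        \<le> binom_k (s + 1) (n + i) * norm (a (n + i))"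
      using assms(1) by (simp add: norm_mult binom_k_nonneg mult_right_mono binom_k_le_plus_1)
  qed
qed

lemma weyl_series_add:
  assumes "0 < s" "a \<in> ell1 (binom_k (s + 1))" "b \<in> ell1 (binom_k (s + 1))"
  shows "weyl_series s (\<lambda>n. a n + b n) = (\<lambda>n. weyl_series s a n + weyl_series s b n)"
  unfolding weyl_series_def fun_eq_iff distrib_left
  using assms by (auto intro!: suminf_add[symmetric] summable_norm_cancel[OF weyl_series_summable])

lemma weyl_series_cmult:
  assumes "0 < s" "a \<in> ell1 (binom_k (s + 1))"
  shows "weyl_series s (\<lambda>n. c * a n) = (\<lambda>n. c * weyl_series s a n)"
proof
  fix n
  have "summable (\<lambda>i. c * (complex_of_real (binom_k s i) * a (n + i)))"
    by (rule summable_mult[OF summable_norm_cancel[OF weyl_series_summable[OF assms]]])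
  then show "weyl_series s (\<lambda>n. c * a n) n = c * weyl_series s a n"
    using suminf_cmult[of c "\<lambda>i. complex_of_real (binom_k s i) * a (n + i)"]
    by (simp add: weyl_series_def mult.left_commute)
qed

lemma
  assumes "\<And>n. 0 \<le> \<rho> n"
    and "summable (\<lambda>l. (\<Sum>n\<le>l. \<bar>binom_k s (l - n)\<bar> * \<rho> n) * norm (b l))"
  shows weyl_series_ell1: "weyl_series s b \<in> ell1 \<rho>"
    and weyl_series_norm_le: "(\<Sum>n. \<rho> n * norm (weyl_series s b n))
      \<le> (\<Sum>l. (\<Sum>n\<le>l. \<bar>binom_k s (l - n)\<bar> * \<rho> n) * norm (b l))"
proof -
  define F where "F l n = complex_of_real (\<rho> n) * (complex_of_real (binom_k s (l - n)) * b l)" for l n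
  have F: "(\<Sum>n\<le>l. norm (F l n)) = (\<Sum>n\<le>l. \<bar>binom_k s (l - n)\<bar> * \<rho> n) * norm (b l)" for l
    using assms(1) by (simp add: F_def norm_mult sum_distrib_left mult_ac)
  have summ: "summable (\<lambda>l. \<Sum>n\<le>l. norm (F l n))"
    unfolding F by (rule assms(2))
  have le: "\<rho> n * norm (weyl_series s b n) \<le> (\<Sum>i. norm (F (n + i) n))" for n
  proof -
    have "summable (\<lambda>i. F (n + i) n)"
      by (rule summable_norm_cancel[OF triangle_summable[OF summ]])
    then have "complex_of_real (\<rho> n) * weyl_series s b n = (\<Sum>i. F (n + i) n)"
      unfolding F_def weyl_series_def by (subst suminf_cmult) simp_all
    then have "\<rho> n * norm (weyl_series s b n) = norm (\<Sum>i. F (n + i) n)"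
      using assms(1)[of n] by (metis abs_of_nonneg norm_mult norm_of_real)
    also have "\<dots> \<le> (\<Sum>i. norm (F (n + i) n))"
      by (rule summable_norm[OF triangle_summable[OF summ]])
    finally show ?thesis .
  qed
  have "summable (\<lambda>n. \<rho> n * norm (weyl_series s b n))"
    by (rule summable_comparison_test'[OF triangle_summable_norm[OF summ]])
      (use le assms(1) in \<open>simp add: abs_mult\<close>)
  then show "weyl_series s b \<in> ell1 \<rho>"
    and "(\<Sum>n. \<rho> n * norm (weyl_series s b n))
      \<le> (\<Sum>l. (\<Sum>n\<le>l. \<bar>binom_k s (l - n)\<bar> * \<rho> n) * norm (b l))"
    using suminf_le[OF le _ triangle_summable_norm[OF summ]] triangle_suminf[of "\<lambda>l n. norm (F l n)"] summ
    by (simp_all add: ell1_def F)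
qed

lemma weyl_series_scaleC:
  fixes H :: "nat \<Rightarrow> 'v::complex_banach"
  assumes "\<And>n. norm (H n) \<le> \<rho> n"
    and "summable (\<lambda>l. (\<Sum>n\<le>l. \<bar>binom_k s (l - n)\<bar> * \<rho> n) * norm (b l))"
  defines "R \<equiv> (\<lambda>l. b l *\<^sub>C (\<Sum>n\<le>l. binom_k s (l - n) *\<^sub>R H n))"
  shows weyl_series_scaleC_sums: "(\<lambda>n. weyl_series s b n *\<^sub>C H n) sums (\<Sum>l. R l)"
    and weyl_series_scaleC_summable: "summable R"
proof -
  define F where "F l n = (complex_of_real (binom_k s (l - n)) * b l) *\<^sub>C H n" for l n
  have R: "R l = (\<Sum>n\<le>l. F l n)" for l
    by (simp add: R_def F_def scaleC.sum_right scaleR_conv_scaleC[of _ "H _"] scaleC_scaleC mult.commute)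
  have summ: "summable (\<lambda>l. \<Sum>n\<le>l. norm (F l n))"
    using assms(2)
  proof (rule summable_comparison_test')
    fix l
    have "(\<Sum>n\<le>l. norm (F l n)) \<le> (\<Sum>n\<le>l. \<bar>binom_k s (l - n)\<bar> * norm (b l) * \<rho> n)"
      unfolding F_def norm_scaleC norm_mult
      by (intro sum_mono mult_mono assms(1)) auto
    then show "norm (\<Sum>n\<le>l. norm (F l n)) \<le> (\<Sum>n\<le>l. \<bar>binom_k s (l - n)\<bar> * \<rho> n) * norm (b l)"
      by (simp add: sum_nonneg sum_distrib_left mult_ac)
  qed
  have "(\<Sum>i. F (n + i) n) = weyl_series s b n *\<^sub>C H n" for n
  proof (cases "H n = 0")
    case False
    have "summable (\<lambda>i. norm (complex_of_real (binom_k s i) * b (n + i)) * norm (H n))"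
      using triangle_summable[OF summ, of n] by (simp add: F_def norm_scaleC)
    then have "summable (\<lambda>i. complex_of_real (binom_k s i) * b (n + i))"
      using False summable_mult_D[of "norm (H n)"]
      by (intro summable_norm_cancel[of "\<lambda>i. complex_of_real (binom_k s i) * b (n + i)"])
        (simp add: mult.commute)
    then show ?thesis
      unfolding F_def weyl_series_def
      using bounded_linear.suminf[OF scaleC.bounded_linear_left, of _ "H n"] by simp
  qed (simp add: F_def scaleC.zero_right)
  then show "(\<lambda>n. weyl_series s b n *\<^sub>C H n) sums (\<Sum>l. R l)"
    using triangle_sums[OF summ] R by simp
  show "summable R"
    by (rule summable_comparison_test'[OF summ]) (simp add: R norm_sum)
qed

locale omega_weight =
  fixes \<alpha> :: real and \<phi> :: "nat \<Rightarrow> real"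
  assumes alpha_pos: "0 < \<alpha>" and weight: "\<phi> \<in> omega_loc \<alpha>"
begin

lemma weight_pos: "0 < \<phi> n"
  using weight by (rule omega_loc_pos)

lemma ell1_binom_k:
  assumes "a \<in> ell1 \<phi>"
  shows "a \<in> ell1 (binom_k (\<alpha> + 1))"
proof -
  obtain c where "0 < c" "\<And>n. c * binom_k (\<alpha> + 1) n \<le> \<phi> n"
    using omega_loc_lower_bound[OF alpha_pos weight] by blast
  then show ?thesis
    using ell1_le[OF assms] alpha_pos by (simp add: binom_k_nonneg)
qed

lemma tau_rep_weyl_series: "tau_rep \<alpha> \<phi> f a \<longleftrightarrow> a \<in> ell1 \<phi> \<and> f = weyl_series \<alpha> a"
  using alpha_pos weight_pos by (intro tau_rep_iff) (simp_all add: less_imp_le)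

lemma weyl_series_inverse_ell1: "a \<in> ell1 \<phi> \<Longrightarrow> weyl_series (- \<alpha>) (weyl_series \<alpha> a) = a"
  using alpha_pos ell1_binom_k by (intro weyl_series_inverse)

lemma weyl_ext_weyl_series:
  assumes "a \<in> ell1 \<phi>"
  shows "weyl_ext \<alpha> \<phi> (weyl_series \<alpha> a) = a"
  unfolding weyl_ext_def tau_rep_weyl_series
  using assms weyl_series_inverse_ell1 by (intro the_equality) (auto, metis)

lemma tau_eq: "tau \<alpha> \<phi> = weyl_series \<alpha> ` ell1 \<phi>"
  by (auto simp: tau_def tau_rep_weyl_series)

lemma tau_norm_weyl_series:
  "a \<in> ell1 \<phi> \<Longrightarrow> tau_norm \<alpha> \<phi> (weyl_series \<alpha> a) = (\<Sum>n. \<phi> n * norm (a n))"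
  by (simp add: tau_norm_def weyl_ext_weyl_series)

lemma cesaro_h_eq: "cesaro_h \<alpha> n m = (if m \<le> n then complex_of_real (binom_k \<alpha> (n - m)) else 0)"
  using alpha_pos by (simp add: cesaro_h_def cesaro_k_eq)

lemma cesaro_h_bound:
  obtains C where "\<And>n. norm (cesaro_h \<alpha> n m) \<le> C * \<phi> n"
proof -
  obtain c where c: "0 < c" "\<And>n. c * binom_k (\<alpha> + 1) n \<le> \<phi> n"
    using omega_loc_lower_bound[OF alpha_pos weight] by blast
  have "norm (cesaro_h \<alpha> n m) \<le> 1 / c * \<phi> n" for n
  proof -
    have "norm (cesaro_h \<alpha> n m) \<le> binom_k (\<alpha> + 1) n"
      using alpha_pos by (simp add: cesaro_h_eq binom_k_nonneg binom_k_le_plus_1)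
    also have "\<dots> \<le> 1 / c * \<phi> n"
      using c by (simp add: field_simps)
    finally show ?thesis .
  qed
  then show thesis
    by (rule that)
qed

lemma cesaro_h_series_sums:
  assumes "a \<in> ell1 \<phi>"
  shows "(\<lambda>n. a n *\<^sub>C cesaro_h \<alpha> n m) sums weyl_series \<alpha> a m"
proof -
  let ?u = "\<lambda>n. a n *\<^sub>C cesaro_h \<alpha> n m"
  obtain C where "\<And>n. norm (cesaro_h \<alpha> n m) \<le> C * \<phi> n"
    using cesaro_h_bound by blast
  then have sums: "?u sums suminf ?u"
    by (rule ell1_series_sums[OF assms])
  then have "suminf ?u = (\<Sum>i. ?u (i + m)) + (\<Sum>n<m. ?u n)"
    by (intro suminf_split_initial_segment) (rule sums_summable)
  also have "(\<Sum>n<m. ?u n) = 0"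
    by (intro sum.neutral) (simp add: cesaro_h_eq scaleC_complex_def)
  also have "(\<Sum>i. ?u (i + m)) = weyl_series \<alpha> a m"
    unfolding weyl_series_def
    by (intro suminf_cong) (simp add: cesaro_h_eq scaleC_complex_def add.commute mult.commute)
  finally show ?thesis
    using sums by simp
qed

lemma conv_cesaro_h:
  "conv (cesaro_h \<alpha> j) (cesaro_h \<alpha> p) m =
    (\<Sum>n\<le>j + p. prod_coeff \<alpha> j p n *\<^sub>R cesaro_h \<alpha> n m)"
proof (rule prod_coeff_expansion[where L = "\<lambda>j p. conv (cesaro_h \<alpha> j) (cesaro_h \<alpha> p) m"])
  have conv_eq: "conv f g m = f 0 * g m + (\<Sum>i<m. f (Suc (m - Suc i)) * g i)"
    for f g :: "nat \<Rightarrow> complex"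
    by (simp add: conv_def atLeast0AtMost Suc_diff_Suc flip: lessThan_Suc_atMost)
  have conv_eq': "conv f g m = f m * g 0 + (\<Sum>i<m. f (m - Suc i) * g (Suc i))"
    for f g :: "nat \<Rightarrow> complex"
    unfolding conv_def atLeast0AtMost lessThan_Suc_atMost[symmetric] sum.lessThan_Suc_shift by simp
  show "conv (cesaro_h \<alpha> 0) (cesaro_h \<alpha> p) m = cesaro_h \<alpha> p m" for p
    unfolding conv_eq by (simp add: cesaro_h_eq)
  have h: "cesaro_h \<alpha> (Suc n) 0 = complex_of_real (binom_k \<alpha> (Suc n))"
    "cesaro_h \<alpha> (Suc n) (Suc i) = cesaro_h \<alpha> n i" for n i
    by (simp_all add: cesaro_h_eq)
  show "conv (cesaro_h \<alpha> (Suc j)) (cesaro_h \<alpha> p) m = conv (cesaro_h \<alpha> j) (cesaro_h \<alpha> (Suc p)) m +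
      binom_k \<alpha> (Suc j) *\<^sub>R cesaro_h \<alpha> p m - binom_k \<alpha> (Suc p) *\<^sub>R cesaro_h \<alpha> j m" for j p
    unfolding conv_eq[of "cesaro_h \<alpha> (Suc j)"] conv_eq'[of "cesaro_h \<alpha> j"] h
    by (simp add: scaleR_conv_of_real mult.commute)
qed

lemma conv_weyl_series:
  assumes "a \<in> ell1 \<phi>" "b \<in> ell1 \<phi>"
  shows "conv (weyl_series \<alpha> a) (weyl_series \<alpha> b) = weyl_series \<alpha> (weyl_prod \<alpha> a b)"
proof
  fix m
  obtain C where C: "\<And>n. norm (cesaro_h \<alpha> n m) \<le> C * \<phi> n"
    using cesaro_h_bound by blast
  have "(\<lambda>n. weyl_prod \<alpha> a b n *\<^sub>C cesaro_h \<alpha> n m) sums conv (weyl_series \<alpha> a) (weyl_series \<alpha> b) m"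
  proof (rule weyl_prod_sums[OF alpha_pos weight assms C conv_cesaro_h])
    show "(\<lambda>p. b p *\<^sub>C conv (cesaro_h \<alpha> j) (cesaro_h \<alpha> p) m) sums
        conv (cesaro_h \<alpha> j) (weyl_series \<alpha> b) m" for j
      using sums_sum[of "{0..m}" "\<lambda>i p. cesaro_h \<alpha> j (m - i) * (b p *\<^sub>C cesaro_h \<alpha> p i)",
          OF sums_mult[OF cesaro_h_series_sums[OF assms(2)]]]
      by (simp add: conv_def scaleC_complex_def sum_distrib_left mult_ac)
    show "(\<lambda>j. a j *\<^sub>C conv (cesaro_h \<alpha> j) (weyl_series \<alpha> b) m) sums
        conv (weyl_series \<alpha> a) (weyl_series \<alpha> b) m"
      using sums_sum[of "{0..m}" "\<lambda>i j. (a j *\<^sub>C cesaro_h \<alpha> j (m - i)) * weyl_series \<alpha> b i",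
          OF sums_mult2[OF cesaro_h_series_sums[OF assms(1)]]]
      by (simp add: conv_def scaleC_complex_def sum_distrib_left mult_ac)
  qed
  then show "conv (weyl_series \<alpha> a) (weyl_series \<alpha> b) m = weyl_series \<alpha> (weyl_prod \<alpha> a b) m"
    using cesaro_h_series_sums[OF weyl_prod_ell1[OF alpha_pos weight assms]] sums_unique2 by blast
qed

lemma cesaro_h_eq_weyl_series: "cesaro_h \<alpha> n = weyl_series \<alpha> (unit_seq n)"
proof
  fix m
  have "(\<lambda>k. unit_seq n k *\<^sub>C cesaro_h \<alpha> k m) sums (\<Sum>k\<in>{n}. unit_seq n k *\<^sub>C cesaro_h \<alpha> k m)"
    by (rule sums_finite) (auto simp: unit_seq_def scaleC_complex_def)
  then have "(\<lambda>k. unit_seq n k *\<^sub>C cesaro_h \<alpha> k m) sums cesaro_h \<alpha> n m"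
    by (simp add: unit_seq_def scaleC_complex_def)
  from sums_unique2[OF this cesaro_h_series_sums[OF ell1_unit_seq]]
  show "cesaro_h \<alpha> n m = weyl_series \<alpha> (unit_seq n) m" .
qed

lemma weyl_ext_fdiff:
  assumes "a \<in> ell1 \<phi>" "b \<in> ell1 \<phi>" "fdiff (weyl_series \<alpha> a) = weyl_series \<alpha> b"
  shows "b n = a (Suc n) - a n"
proof -
  let ?K = "binom_k (\<alpha> + 1)"
  define a' where "a' n = a (Suc n)" for n
  have "summable (\<lambda>n. ?K (Suc n) * norm (a (Suc n)))"
    using ell1_binom_k[OF assms(1)] summable_Suc_iff[of "\<lambda>n. ?K n * norm (a n)"]
    by (simp add: ell1_def)
  then have a': "a' \<in> ell1 ?K"
    unfolding ell1_def mem_Collect_eq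
  proof (rule summable_comparison_test')
    show "norm (?K n * norm (a' n)) \<le> ?K (Suc n) * norm (a (Suc n))" for n
      using alpha_pos by (simp add: a'_def abs_mult binom_k_nonneg mult_right_mono binom_k_mono)
  qed
  let ?d = "\<lambda>n. a' n + (-1) * a n"
  have minus_a: "(\<lambda>n. (-1) * a n) \<in> ell1 ?K"
    using ell1_binom_k[OF assms(1)] by (rule ell1_cmult)
  have d: "?d \<in> ell1 ?K"
    using a' minus_a alpha_pos by (intro ell1_add) (auto intro: binom_k_nonneg)
  have "weyl_series \<alpha> ?d = weyl_series \<alpha> b"
    unfolding assms(3)[symmetric] weyl_series_add[OF alpha_pos a' minus_a]
      weyl_series_cmult[OF alpha_pos ell1_binom_k[OF assms(1)]]
    by (simp add: fun_eq_iff fdiff_def weyl_series_def a'_def)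
  then have "?d = b"
    using weyl_series_inverse[OF alpha_pos d] weyl_series_inverse_ell1[OF assms(2)] by metis
  then show ?thesis
    by (auto simp: a'_def)
qed

end

subsection \<open>The functional calculus\<close>

lemma bounded_clinear_id: "bounded_clinear (\<lambda>x. x)"
  by (simp add: bounded_clinear_def bounded_linear_ident)

lemma bounded_clinear_compose:
  "bounded_clinear S \<Longrightarrow> bounded_clinear R \<Longrightarrow> bounded_clinear (\<lambda>x. S (R x))"
  by (simp add: bounded_clinear_def bounded_linear_compose)

lemma bounded_clinear_scaleR: "bounded_clinear S \<Longrightarrow> bounded_clinear (\<lambda>x. r *\<^sub>R S x)"
  by (auto simp: bounded_clinear_def scaleR_conv_scaleC[of r] scaleC_left_commute
      simp flip: scaleC_of_real[of r] intro: bounded_linear_compose[OF scaleC.bounded_linear_right])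

lemma bounded_clinear_sum:
  "(\<And>i. i \<in> I \<Longrightarrow> bounded_clinear (S i)) \<Longrightarrow> bounded_clinear (\<lambda>x. \<Sum>i\<in>I. S i x)"
  by (simp add: bounded_clinear_def bounded_linear_sum scaleC.sum_right)

lemma bounded_clinear_funpow: "bounded_clinear T \<Longrightarrow> bounded_clinear (T ^^ n)"
proof (induction n)
  case 0
  then show ?case
    using bounded_clinear_id by (simp add: id_def)
next
  case (Suc n)
  then show ?case
    using bounded_clinear_compose[of T "T ^^ n"] by (simp add: o_def)
qed

lemma bounded_clinear_cesaro_sum: "bounded_clinear T \<Longrightarrow> bounded_clinear (cesaro_sum \<alpha> T n)"
  unfolding cesaro_sum_def
  by (intro bounded_clinear_sum bounded_clinear_scaleR bounded_clinear_funpow)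

lemma norm_funpow_le:
  assumes "bounded_clinear T" "onorm T \<le> a"
  shows "norm ((T ^^ n) x) \<le> a ^ n * norm x"
proof -
  have T: "bounded_linear T"
    using assms(1) by (simp add: bounded_clinear_def)
  have a: "0 \<le> a"
    using onorm_pos_le[OF T] assms(2) by simp
  show ?thesis
  proof (induction n)
    case (Suc n)
    have "norm (T ((T ^^ n) x)) \<le> onorm T * norm ((T ^^ n) x)"
      by (rule onorm[OF T])
    also have "\<dots> \<le> a * (a ^ n * norm x)"
      using assms(2) Suc a by (intro mult_mono) auto
    finally show ?case
      by (simp add: mult.assoc)
  qed simp
qed

lemma cesaro_sum_0: "0 < \<alpha> \<Longrightarrow> cesaro_sum \<alpha> T 0 x = x"
  by (simp add: cesaro_sum_def cesaro_k_eq)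

lemma cesaro_sum_Suc:
  assumes "0 < \<alpha>" "bounded_clinear T"
  shows "cesaro_sum \<alpha> T (Suc n) x = binom_k \<alpha> (Suc n) *\<^sub>R x + T (cesaro_sum \<alpha> T n x)"
proof -
  have "linear T"
    using assms(2) by (simp add: bounded_clinear_def bounded_linear.linear)
  then show ?thesis
    using assms(1) unfolding cesaro_sum_def sum.atLeast0_atMost_Suc_shift
    by (simp add: cesaro_k_eq linear_sum linear_scale)
qed

lemma cesaro_sum_commute:
  assumes "bounded_clinear T"
  shows "cesaro_sum \<alpha> T n (T x) = T (cesaro_sum \<alpha> T n x)"
proof -
  have "linear T"
    using assms by (simp add: bounded_clinear_def bounded_linear.linear)
  then show ?thesis
    by (simp add: cesaro_sum_def funpow_swap1 linear_sum linear_scale)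
qed

lemma cesaro_sum_add:
  assumes "0 < s" "0 < t"
  shows "(\<Sum>n\<le>l. binom_k s (l - n) *\<^sub>R cesaro_sum t T n x) = cesaro_sum (s + t) T l x"
proof -
  have "(\<Sum>n\<le>l. binom_k s (l - n) *\<^sub>R cesaro_sum t T n x)
      = (\<Sum>n\<le>l. \<Sum>j\<le>n. (binom_k s (l - n) * binom_k t (n - j)) *\<^sub>R (T ^^ j) x)"
    using assms by (simp add: cesaro_sum_def cesaro_k_eq scaleR_sum_right atLeast0AtMost)
  also have "\<dots> = (\<Sum>j\<le>l. \<Sum>m\<le>l - j. (binom_k s (l - j - m) * binom_k t m) *\<^sub>R (T ^^ j) x)"
    unfolding sum.Sigma[OF finite_atMost ballI[OF finite_atMost]]
    by (rule sum.reindex_bij_witness[where i = "\<lambda>(j, m). (j + m, j)" and j = "\<lambda>(n, j). (j, n - j)"])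
      auto
  also have "\<dots> = (\<Sum>j\<le>l. binom_k (s + t) (l - j) *\<^sub>R (T ^^ j) x)"
    unfolding add.commute[of s t] binom_k_add by (simp add: scaleR_sum_left mult.commute)
  finally show ?thesis
    using assms by (simp add: cesaro_sum_def cesaro_k_eq atLeast0AtMost)
qed

lemma cesaro_sum_product:
  assumes "0 < \<alpha>" "bounded_clinear T"
  shows "cesaro_sum \<alpha> T j (cesaro_sum \<alpha> T p x) =
    (\<Sum>n\<le>j + p. prod_coeff \<alpha> j p n *\<^sub>R cesaro_sum \<alpha> T n x)"
proof (rule prod_coeff_expansion[where L = "\<lambda>j p. cesaro_sum \<alpha> T j (cesaro_sum \<alpha> T p x)"])
  show "cesaro_sum \<alpha> T 0 (cesaro_sum \<alpha> T p x) = cesaro_sum \<alpha> T p x" for p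
    using assms(1) by (rule cesaro_sum_0)
  fix j p
  have "linear (cesaro_sum \<alpha> T j)"
    using bounded_clinear_cesaro_sum[OF assms(2)] by (simp add: bounded_clinear_def bounded_linear.linear)
  then show "cesaro_sum \<alpha> T (Suc j) (cesaro_sum \<alpha> T p x) = cesaro_sum \<alpha> T j (cesaro_sum \<alpha> T (Suc p) x) +
      binom_k \<alpha> (Suc j) *\<^sub>R cesaro_sum \<alpha> T p x - binom_k \<alpha> (Suc p) *\<^sub>R cesaro_sum \<alpha> T j x"
    by (simp add: cesaro_sum_Suc[OF assms] linear_add linear_scale cesaro_sum_commute[OF assms(2)])
qed

locale cesaro_bounded = omega_weight +
  fixes T :: "'a::complex_banach \<Rightarrow> 'a" and C :: real
  assumes T: "bounded_clinear T" and onorm_cesaro_sum: "onorm (cesaro_sum \<alpha> T n) \<le> C * \<phi> n"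
begin

definition calculus :: "(nat \<Rightarrow> complex) \<Rightarrow> 'a \<Rightarrow> 'a"
  where "calculus a x = (\<Sum>n. a n *\<^sub>C cesaro_sum \<alpha> T n x)"

lemma T_scaleC: "T (c *\<^sub>C x) = c *\<^sub>C T x" and T_bounded_linear: "bounded_linear T"
  using T by (simp_all add: bounded_clinear_def)

lemma cesaro_sum_scaleC: "cesaro_sum \<alpha> T n (c *\<^sub>C x) = c *\<^sub>C cesaro_sum \<alpha> T n x"
  and cesaro_sum_bounded_linear: "bounded_linear (cesaro_sum \<alpha> T n)"
  using bounded_clinear_cesaro_sum[OF T] by (simp_all add: bounded_clinear_def)

lemma norm_cesaro_sum_le: "norm (cesaro_sum \<alpha> T n x) \<le> C * norm x * \<phi> n"
proof -
  have "norm (cesaro_sum \<alpha> T n x) \<le> onorm (cesaro_sum \<alpha> T n) * norm x"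
    by (rule onorm[OF cesaro_sum_bounded_linear])
  also have "\<dots> \<le> C * \<phi> n * norm x"
    by (intro mult_right_mono onorm_cesaro_sum) simp
  finally show ?thesis
    by (simp add: mult_ac)
qed

lemma C_nonneg: "0 \<le> C"
proof -
  have "0 \<le> C * \<phi> 0"
    using onorm_pos_le[OF cesaro_sum_bounded_linear, of 0] onorm_cesaro_sum[of 0] by linarith
  then show ?thesis
    using weight_pos[of 0] by (simp add: zero_le_mult_iff)
qed

lemma calculus_sums:
  assumes "a \<in> ell1 \<phi>"
  shows "(\<lambda>n. a n *\<^sub>C cesaro_sum \<alpha> T n x) sums calculus a x"
  unfolding calculus_def by (rule ell1_series_sums[OF assms norm_cesaro_sum_le])

lemma norm_calculus_le:
  assumes "a \<in> ell1 \<phi>"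
  shows "norm (calculus a x) \<le> C * (\<Sum>n. \<phi> n * norm (a n)) * norm x"
  unfolding calculus_def using ell1_series_norm_le[OF assms norm_cesaro_sum_le, of x]
  by (simp add: mult_ac)

lemma calculus_add:
  assumes "a \<in> ell1 \<phi>" "b \<in> ell1 \<phi>"
  shows "calculus (\<lambda>n. a n + b n) x = calculus a x + calculus b x"
  using sums_add[OF calculus_sums[OF assms(1), of x] calculus_sums[OF assms(2), of x]]
  by (simp add: calculus_def sums_iff scaleC_add_left)

lemma calculus_cmult:
  assumes "a \<in> ell1 \<phi>"
  shows "calculus (\<lambda>n. c * a n) x = c *\<^sub>C calculus a x"
  using bounded_linear.sums[OF scaleC.bounded_linear_right calculus_sums[OF assms], of c x]
  by (simp add: calculus_def sums_iff scaleC_scaleC)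

lemma calculus_bounded_clinear:
  assumes "a \<in> ell1 \<phi>"
  shows "bounded_clinear (calculus a)"
proof -
  have "calculus a (x + y) = calculus a x + calculus a y" for x y
    using sums_add[OF calculus_sums[OF assms, of x] calculus_sums[OF assms, of y]]
    by (simp add: calculus_def sums_iff scaleC_add_right bounded_linear.linear[OF cesaro_sum_bounded_linear]
        linear_add)
  moreover have scaleC: "calculus a (c *\<^sub>C x) = c *\<^sub>C calculus a x" for c x
    using bounded_linear.sums[OF scaleC.bounded_linear_right calculus_sums[OF assms], of c x]
    by (simp add: calculus_def sums_iff cesaro_sum_scaleC scaleC_left_commute)
  ultimately have "bounded_linear (calculus a)"
    using norm_calculus_le[OF assms]
    by (intro bounded_linear_intro[where K = "C * (\<Sum>n. \<phi> n * norm (a n))"])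
      (simp_all add: scaleR_conv_scaleC mult.commute)
  then show ?thesis
    using scaleC by (simp add: bounded_clinear_def)
qed

lemma onorm_calculus_le:
  assumes "a \<in> ell1 \<phi>"
  shows "onorm (calculus a) \<le> C * (\<Sum>n. \<phi> n * norm (a n))"
proof (rule onorm_bound)
  have "0 \<le> (\<Sum>n. \<phi> n * norm (a n))"
    using assms weight_pos by (intro suminf_nonneg) (auto simp: ell1_def less_imp_le)
  then show "0 \<le> C * (\<Sum>n. \<phi> n * norm (a n))"
    using C_nonneg by simp
qed (rule norm_calculus_le[OF assms])

lemma calculus_weyl_prod:
  assumes "a \<in> ell1 \<phi>" "b \<in> ell1 \<phi>"
  shows "calculus (weyl_prod \<alpha> a b) x = calculus a (calculus b x)"
proof -
  have "(\<lambda>n. weyl_prod \<alpha> a b n *\<^sub>C cesaro_sum \<alpha> T n x) sums calculus a (calculus b x)"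
  proof (rule weyl_prod_sums[OF alpha_pos weight assms norm_cesaro_sum_le
        cesaro_sum_product[OF alpha_pos T]])
    show "(\<lambda>p. b p *\<^sub>C cesaro_sum \<alpha> T j (cesaro_sum \<alpha> T p x)) sums
        cesaro_sum \<alpha> T j (calculus b x)" for j
      using bounded_linear.sums[OF cesaro_sum_bounded_linear calculus_sums[OF assms(2)], of j x]
      by (simp add: cesaro_sum_scaleC)
  qed (rule calculus_sums[OF assms(1)])
  then show ?thesis
    by (simp add: calculus_def sums_iff)
qed

lemma calculus_unit_seq: "calculus (unit_seq n) = cesaro_sum \<alpha> T n"
proof
  fix x
  have "(\<lambda>k. unit_seq n k *\<^sub>C cesaro_sum \<alpha> T k x) sums
      (\<Sum>k\<in>{n}. unit_seq n k *\<^sub>C cesaro_sum \<alpha> T k x)"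
    by (rule sums_finite) (auto simp: unit_seq_def scaleC.zero_left)
  then show "calculus (unit_seq n) x = cesaro_sum \<alpha> T n x"
    by (simp add: calculus_def sums_iff unit_seq_def scaleC_one)
qed

lemma calculus_fdiff:
  assumes "a \<in> ell1 \<phi>" "b \<in> ell1 \<phi>" "\<And>n. b n = a (Suc n) - a n"
  shows "T (calculus b x) = calculus a x - T (calculus a x) - weyl_series \<alpha> a 0 *\<^sub>C x"
proof -
  let ?S = "cesaro_sum \<alpha> T"
  have T_sums: "(\<lambda>n. d n *\<^sub>C T (?S n x)) sums T (calculus d x)" if "d \<in> ell1 \<phi>" for d
    using bounded_linear.sums[OF T_bounded_linear calculus_sums[OF that], of x] by (simp add: T_scaleC)
  have "summable (\<lambda>i. complex_of_real (binom_k \<alpha> i) * a (0 + i))"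
    by (rule summable_norm_cancel[OF weyl_series_summable[OF alpha_pos ell1_binom_k[OF assms(1)]]])
  then have "(\<lambda>i. complex_of_real (binom_k \<alpha> i) * a i) sums weyl_series \<alpha> a 0"
    by (simp add: weyl_series_def summable_sums)
  then have "(\<lambda>i. complex_of_real (binom_k \<alpha> (Suc i)) * a (Suc i)) sums (weyl_series \<alpha> a 0 - a 0)"
    by (subst sums_Suc_iff) simp
  then have k_sums: "(\<lambda>n. (complex_of_real (binom_k \<alpha> (Suc n)) * a (Suc n)) *\<^sub>C x) sums
      ((weyl_series \<alpha> a 0 - a 0) *\<^sub>C x)"
    by (rule bounded_linear.sums[OF scaleC.bounded_linear_left])
  have "(\<lambda>n. a (Suc n) *\<^sub>C ?S (Suc n) x) sums (calculus a x - a 0 *\<^sub>C x)"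
    using calculus_sums[OF assms(1), of x]
    by (subst sums_Suc_iff) (simp add: cesaro_sum_0[OF alpha_pos])
  then have "(\<lambda>n. a (Suc n) *\<^sub>C T (?S n x)) sums
      (calculus a x - a 0 *\<^sub>C x - (weyl_series \<alpha> a 0 - a 0) *\<^sub>C x)"
    using sums_diff[OF _ k_sums] by (fastforce simp: cesaro_sum_Suc[OF alpha_pos T] scaleC_add_right
        scaleR_conv_scaleC[of _ x] scaleC_scaleC mult.commute)
  from sums_diff[OF this T_sums[OF assms(1)]]
  have "(\<lambda>n. b n *\<^sub>C T (?S n x)) sums
      (calculus a x - a 0 *\<^sub>C x - (weyl_series \<alpha> a 0 - a 0) *\<^sub>C x - T (calculus a x))"
    by (simp add: assms(3) scaleC.diff_left)
  from sums_unique2[OF T_sums[OF assms(2)] this] show ?thesis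
    by (simp add: scaleC.diff_left)
qed

lemma calculus_higher_order:
  assumes "\<alpha> < \<beta>" "\<psi> \<in> omega_loc \<beta>" "b \<in> ell1 \<psi>"
    and M: "\<And>n. conv (cesaro_k (\<beta> - \<alpha>)) \<phi> n \<le> M * \<psi> n"
  defines "a \<equiv> weyl_series (\<beta> - \<alpha>) b"
  shows "a \<in> ell1 \<phi>" "weyl_series \<alpha> a = weyl_series \<beta> b"
    and "(\<Sum>n. \<phi> n * norm (a n)) \<le> M * (\<Sum>n. \<psi> n * norm (b n))"
    and "(\<lambda>n. b n *\<^sub>C cesaro_sum \<beta> T n x) sums calculus a x"
proof -
  interpret higher: omega_weight \<beta> \<psi>
    using assms alpha_pos by unfold_locales auto
  let ?s = "\<beta> - \<alpha>"
  have s: "0 < ?s"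
    using assms(1) by simp
  have M': "(\<Sum>n\<le>l. \<bar>binom_k ?s (l - n)\<bar> * \<phi> n) * norm (b l) \<le> M * (\<psi> l * norm (b l))" for l
    using mult_right_mono[OF M[of l], of "norm (b l)"] s
    by (simp add: conv_def cesaro_k_eq atLeast0AtMost binom_k_nonneg mult.assoc)
  have "summable (\<lambda>l. M * (\<psi> l * norm (b l)))"
    using assms(3) by (intro summable_mult) (simp add: ell1_def)
  then have summ: "summable (\<lambda>l. (\<Sum>n\<le>l. \<bar>binom_k ?s (l - n)\<bar> * \<phi> n) * norm (b l))"
    by (rule summable_comparison_test')
      (use M' weight_pos in \<open>simp add: abs_mult sum_nonneg less_imp_le\<close>)
  show a: "a \<in> ell1 \<phi>"
    unfolding a_def by (rule weyl_series_ell1[OF _ summ]) (simp add: weight_pos less_imp_le)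
  have "(\<Sum>n. \<phi> n * norm (a n))
      \<le> (\<Sum>l. (\<Sum>n\<le>l. \<bar>binom_k ?s (l - n)\<bar> * \<phi> n) * norm (b l))"
    unfolding a_def by (rule weyl_series_norm_le[OF _ summ]) (simp add: weight_pos less_imp_le)
  also have "\<dots> \<le> (\<Sum>l. M * (\<psi> l * norm (b l)))"
    by (intro suminf_le M' summ) fact
  also have "\<dots> = M * (\<Sum>n. \<psi> n * norm (b n))"
    using assms(3) by (intro suminf_mult) (simp add: ell1_def)
  finally show "(\<Sum>n. \<phi> n * norm (a n)) \<le> M * (\<Sum>n. \<psi> n * norm (b n))" .
  have \<beta>: "\<beta> = \<alpha> + ?s"
    by simp
  show "weyl_series \<alpha> a = weyl_series \<beta> b"
  proof
    fix n
    have "summable (\<lambda>l. norm (complex_of_real (binom_k (\<alpha> + ?s) l) * b (n + l)))"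
      using weyl_series_summable[OF higher.alpha_pos higher.ell1_binom_k[OF assms(3)]] by simp
    then have "summable (\<lambda>l. (\<Sum>j\<le>l. \<bar>binom_k \<alpha> j\<bar> * \<bar>binom_k ?s (l - j)\<bar>) * norm (b (n + l)))"
      using alpha_pos s unfolding norm_mult binom_k_add norm_of_real
      by (simp add: binom_k_nonneg sum_nonneg)
    then have "weyl_series \<alpha> a n = weyl_series (\<alpha> + ?s) b n"
      unfolding a_def by (rule weyl_series_compose)
    then show "weyl_series \<alpha> a n = weyl_series \<beta> b n"
      by simp
  qed
  have "summable (\<lambda>l. C * norm x * ((\<Sum>n\<le>l. \<bar>binom_k ?s (l - n)\<bar> * \<phi> n) * norm (b l)))"
    by (rule summable_mult[OF summ])
  then have summ': "summable (\<lambda>l. (\<Sum>n\<le>l. \<bar>binom_k ?s (l - n)\<bar> * (C * norm x * \<phi> n)) * norm (b l))"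
    by (simp add: sum_distrib_left mult_ac)
  have "(\<Sum>n\<le>l. binom_k ?s (l - n) *\<^sub>R cesaro_sum \<alpha> T n x) = cesaro_sum \<beta> T l x" for l
    using cesaro_sum_add[OF s alpha_pos] by simp
  with weyl_series_scaleC[OF norm_cesaro_sum_le summ']
  have "(\<lambda>n. a n *\<^sub>C cesaro_sum \<alpha> T n x) sums (\<Sum>l. b l *\<^sub>C cesaro_sum \<beta> T l x)"
    and "summable (\<lambda>l. b l *\<^sub>C cesaro_sum \<beta> T l x)"
    by (simp_all add: a_def)
  then show "(\<lambda>n. b n *\<^sub>C cesaro_sum \<beta> T n x) sums calculus a x"
    using sums_unique2[OF calculus_sums[OF a]] by (metis summable_sums)
qed

text \<open>Interchanging the sums in \<open>\<Sum>n. f n *\<^sub>C (T ^^ n) x\<close> with \<open>f = weyl_series \<alpha> g\<close> requires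
  the convolution of \<open>binom_k \<alpha>\<close> with \<open>a ^ n\<close> to be dominated by a weight for which \<open>g\<close> is
  summable. If \<open>a \<le> 1\<close>, this is \<open>binom_k (\<alpha> + 1)\<close>. If \<open>a > 1\<close>, it is \<open>a ^ n\<close>, since
  then \<open>g = weyl_series (- \<alpha>) f\<close> inherits the exponential decay of \<open>f\<close>.\<close>
lemma calculus_power_series:
  assumes "0 < a" "onorm T \<le> a" "g \<in> ell1 \<phi>" "weyl_series \<alpha> g \<in> ell1 (\<lambda>n. a ^ n)"
  shows "(\<lambda>n. weyl_series \<alpha> g n *\<^sub>C (T ^^ n) x) sums calculus g x"
proof -
  have summ: "summable (\<lambda>l. (\<Sum>n\<le>l. \<bar>binom_k \<alpha> (l - n)\<bar> * a ^ n) * norm (g l))"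
  proof (cases "a \<le> 1")
    case True
    have "summable (\<lambda>l. binom_k (\<alpha> + 1) l * norm (g l))"
      using ell1_binom_k[OF assms(3)] by (simp add: ell1_def)
    then show ?thesis
    proof (rule summable_comparison_test')
      fix l
      have "(\<Sum>n\<le>l. \<bar>binom_k \<alpha> (l - n)\<bar> * a ^ n) \<le> (\<Sum>n\<le>l. binom_k \<alpha> (l - n))"
      proof (rule sum_mono)
        show "\<bar>binom_k \<alpha> (l - n)\<bar> * a ^ n \<le> binom_k \<alpha> (l - n)" for n
          using mult_left_mono[of "a ^ n" 1 "\<bar>binom_k \<alpha> (l - n)\<bar>"] True assms(1) alpha_pos
          by (simp add: power_le_one binom_k_nonneg)
      qed
      also have "\<dots> = binom_k (\<alpha> + 1) l"
        unfolding binom_k_plus_1_sum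
        by (rule sum.reindex_bij_witness[where i = "\<lambda>n. l - n" and j = "\<lambda>n. l - n"]) auto
      finally show "norm ((\<Sum>n\<le>l. \<bar>binom_k \<alpha> (l - n)\<bar> * a ^ n) * norm (g l))
          \<le> binom_k (\<alpha> + 1) l * norm (g l)"
        using assms(1) by (simp add: abs_mult sum_nonneg mult_right_mono)
    qed
  next
    case False
    have conv_le: "summable (\<lambda>l. (\<Sum>n\<le>l. \<bar>binom_k s (l - n)\<bar> * a ^ n) * norm (h l))"
      if s: "summable (\<lambda>n. \<bar>binom_k s n\<bar> * (1 / a) ^ n)" and h: "h \<in> ell1 (\<lambda>n. a ^ n)" for s h
    proof -
      let ?B = "\<Sum>n. \<bar>binom_k s n\<bar> * (1 / a) ^ n"
      have "summable (\<lambda>l. ?B * (a ^ l * norm (h l)))"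
        using h by (intro summable_mult) (simp add: ell1_def)
      then show ?thesis
      proof (rule summable_comparison_test')
        fix l
        have "(\<Sum>n\<le>l. \<bar>binom_k s (l - n)\<bar> * a ^ n) = (\<Sum>m\<le>l. a ^ l * (\<bar>binom_k s m\<bar> * (1 / a) ^ m))"
          using assms(1)
          by (intro sum.reindex_bij_witness[where i = "\<lambda>n. l - n" and j = "\<lambda>n. l - n"])
            (auto simp: power_diff power_one_over field_simps)
        also have "\<dots> = a ^ l * (\<Sum>m\<le>l. \<bar>binom_k s m\<bar> * (1 / a) ^ m)"
          by (simp add: sum_distrib_left)
        also have "\<dots> \<le> a ^ l * ?B"
          using assms(1) s by (intro mult_left_mono sum_le_suminf) auto
        finally have "(\<Sum>n\<le>l. \<bar>binom_k s (l - n)\<bar> * a ^ n) \<le> a ^ l * ?B" .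
        from mult_right_mono[OF this, of "norm (h l)"]
        show "norm ((\<Sum>n\<le>l. \<bar>binom_k s (l - n)\<bar> * a ^ n) * norm (h l)) \<le> ?B * (a ^ l * norm (h l))"
          using assms(1) by (simp add: abs_mult sum_nonneg mult_ac)
      qed
    qed
    have "summable (\<lambda>n. \<bar>binom_k (- \<alpha>) n\<bar> * (1 / a) ^ n)"
      by (rule summable_comparison_test'[OF summable_abs_binom_k_minus[OF alpha_pos]])
        (use False in \<open>auto simp: abs_mult power_le_one intro!: mult_left_le\<close>)
    then have "weyl_series (- \<alpha>) (weyl_series \<alpha> g) \<in> ell1 (\<lambda>n. a ^ n)"
      using weyl_series_ell1[OF _ conv_le[OF _ assms(4)]] assms(1) by simp
    then have g: "g \<in> ell1 (\<lambda>n. a ^ n)"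
      using weyl_series_inverse_ell1[OF assms(3)] by simp
    have "(\<lambda>n. ((- \<alpha>) gchoose n) * (- (1 / a)) ^ n) sums (1 + - (1 / a)) powr (- \<alpha>)"
      using False by (intro gen_binomial_real) auto
    moreover have "((- \<alpha>) gchoose n) * (- (1 / a)) ^ n = \<bar>binom_k \<alpha> n\<bar> * (1 / a) ^ n" for n
    proof -
      have "((- \<alpha>) gchoose n) = (- 1) ^ n * binom_k \<alpha> n"
        by (simp add: gbinomial_pochhammer binom_k_def)
      moreover have "(- (1 / a)) ^ n = (- 1) ^ n * (1 / a) ^ n"
        by (rule power_minus)
      ultimately show ?thesis
        using alpha_pos by (simp add: binom_k_nonneg flip: power_mult_distrib)
    qed
    ultimately have "summable (\<lambda>n. \<bar>binom_k \<alpha> n\<bar> * (1 / a) ^ n)"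
      by (simp add: sums_iff)
    then show ?thesis
      using g by (rule conv_le)
  qed
  then have "summable (\<lambda>l. norm x * ((\<Sum>n\<le>l. \<bar>binom_k \<alpha> (l - n)\<bar> * a ^ n) * norm (g l)))"
    by (rule summable_mult)
  then have summ': "summable (\<lambda>l. (\<Sum>n\<le>l. \<bar>binom_k \<alpha> (l - n)\<bar> * (a ^ n * norm x)) * norm (g l))"
    by (simp add: sum_distrib_left mult_ac)
  have "(\<Sum>n\<le>l. binom_k \<alpha> (l - n) *\<^sub>R (T ^^ n) x) = cesaro_sum \<alpha> T l x" for l
    using alpha_pos by (simp add: cesaro_sum_def cesaro_k_eq atLeast0AtMost)
  with weyl_series_scaleC_sums[OF norm_funpow_le[OF T assms(2)] summ'] show ?thesis
    by (simp add: calculus_def)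
qed

end

lemma resolvent_power_series:
  fixes T :: "'a::complex_banach \<Rightarrow> 'a"
  assumes T: "bounded_clinear T" and "onorm T \<le> a" "a < norm z"
    and R: "\<And>x. (\<lambda>n. p_seq z n *\<^sub>C (T ^^ n) x) sums R x"
  shows "R \<circ> (\<lambda>x. z *\<^sub>C x - T x) = id" "(\<lambda>x. z *\<^sub>C x - T x) \<circ> R = id"
proof -
  have T_lin: "bounded_linear T" and T_scaleC: "\<And>c x. T (c *\<^sub>C x) = c *\<^sub>C T x"
    using T by (simp_all add: bounded_clinear_def)
  have a: "0 \<le> a"
    using onorm_pos_le[OF T_lin] assms(2) by simp
  then have z: "z \<noteq> 0"
    using assms(3) by auto
  have TR: "(\<lambda>n. p_seq z n *\<^sub>C (T ^^ Suc n) x) sums T (R x)" for x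
    using bounded_linear.sums[OF T_lin R[of x]] by (simp add: T_scaleC)
  have R_T: "R (T x) = T (R x)" for x
    using sums_unique2[OF R[of "T x"]] TR[of x] by (simp add: funpow_swap1)
  have R_scaleC: "R (c *\<^sub>C x) = c *\<^sub>C R x" for c x
  proof -
    have "(T ^^ n) (c *\<^sub>C x) = c *\<^sub>C (T ^^ n) x" for n
      using bounded_clinear_funpow[OF T] by (simp add: bounded_clinear_def)
    then show ?thesis
      using bounded_linear.sums[OF scaleC.bounded_linear_right R[of x], of c] R[of "c *\<^sub>C x"]
      by (simp add: scaleC_left_commute sums_iff)
  qed
  have R_diff: "R (x - y) = R x - R y" for x y
  proof -
    have "(T ^^ n) (x - y) = (T ^^ n) x - (T ^^ n) y" for n
      using bounded_clinear_funpow[OF T]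
      by (simp add: bounded_clinear_def linear_diff bounded_linear.linear)
    then show ?thesis
      using sums_diff[OF R[of x] R[of y]] R[of "x - y"] by (simp add: scaleC.diff_right sums_iff)
  qed
  have inv: "z *\<^sub>C R x - T (R x) = x" for x
  proof -
    define u where "u n = (1 / z ^ n) *\<^sub>C (T ^^ n) x" for n
    have "(\<lambda>n. z *\<^sub>C (p_seq z n *\<^sub>C (T ^^ n) x) - p_seq z n *\<^sub>C (T ^^ Suc n) x) sums
        (z *\<^sub>C R x - T (R x))"
      by (intro sums_diff bounded_linear.sums[OF scaleC.bounded_linear_right] R TR)
    moreover have "z *\<^sub>C (p_seq z n *\<^sub>C (T ^^ n) x) - p_seq z n *\<^sub>C (T ^^ Suc n) x = u n - u (Suc n)"
      for n
      using z by (simp add: u_def p_seq_def scaleC_scaleC)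
    moreover have "u \<longlonglongrightarrow> 0"
    proof (rule Lim_null_comparison)
      have "norm (u n) \<le> (a / norm z) ^ n * norm x" for n
      proof -
        have "norm (u n) \<le> (1 / norm z ^ n) * (a ^ n * norm x)"
          unfolding u_def norm_scaleC using norm_funpow_le[OF T assms(2)]
          by (simp add: norm_divide norm_power divide_right_mono)
        then show ?thesis
          by (simp add: power_divide)
      qed
      then show "\<forall>\<^sub>F n in sequentially. norm (u n) \<le> (a / norm z) ^ n * norm x"
        by simp
      have "(\<lambda>n. (a / norm z) ^ n) \<longlonglongrightarrow> 0"
        using a assms(3) z by (intro LIMSEQ_realpow_zero) (simp_all add: pos_divide_less_eq)
      then show "(\<lambda>n. (a / norm z) ^ n * norm x) \<longlonglongrightarrow> 0"
        by (rule tendsto_mult_left_zero)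
    qed
    then have "(\<lambda>n. u n - u (Suc n)) sums (u 0 - 0)"
      by (rule telescope_sums')
    ultimately show ?thesis
      using sums_unique2 by (fastforce simp: u_def scaleC_one)
  qed
  then show "(\<lambda>x. z *\<^sub>C x - T x) \<circ> R = id"
    by (simp add: fun_eq_iff)
  show "R \<circ> (\<lambda>x. z *\<^sub>C x - T x) = id"
    using inv by (simp add: fun_eq_iff R_diff R_scaleC R_T)
qed

theorem theorem5:
  fixes T :: "'a::complex_banach \<Rightarrow> 'a" and \<alpha> C :: real and \<phi> :: "nat \<Rightarrow> real"
  assumes "0 < \<alpha>"
    and "bounded_clinear T"
    and "\<phi> \<in> omega_loc \<alpha>"
    and "0 < C"
    and "\<And>n. onorm (cesaro_sum \<alpha> T n) \<le> C * \<phi> n"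
  shows "\<exists>\<theta> :: (nat \<Rightarrow> complex) \<Rightarrow> 'a \<Rightarrow> 'a.
    bounded_algebra_hom (tau \<alpha> \<phi>) (tau_norm \<alpha> \<phi>) \<theta> \<and>
    (\<forall>f\<in>tau \<alpha> \<phi>. \<forall>x. (\<lambda>n. weyl_ext \<alpha> \<phi> f n *\<^sub>C cesaro_sum \<alpha> T n x) sums \<theta> f x) \<and>
    \<comment> \<open>(i)\<close>
    (\<forall>n. cesaro_h \<alpha> n \<in> tau \<alpha> \<phi> \<and> \<theta> (cesaro_h \<alpha> n) = cesaro_sum \<alpha> T n) \<and>
    \<theta> (unit_seq 0) = id \<and> \<theta> (unit_seq 1) = T \<and>
    \<comment> \<open>(ii)\<close>
    (\<forall>f\<in>tau \<alpha> \<phi>. fdiff f \<in> tau \<alpha> \<phi> \<longrightarrow>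
      (\<forall>x. T (\<theta> (fdiff f) x) = (\<theta> f x - T (\<theta> f x)) - f 0 *\<^sub>C x)) \<and>
    \<comment> \<open>(iii)\<close>
    (\<forall>\<beta> \<psi>. \<alpha> < \<beta> \<and> \<psi> \<in> omega_loc \<beta> \<and>
        bdd_above (range (\<lambda>n. conv (cesaro_k (\<beta> - \<alpha>)) \<phi> n / \<psi> n)) \<longrightarrow>
      tau \<beta> \<psi> \<subseteq> tau \<alpha> \<phi> \<and>
      (\<exists>K. \<forall>f\<in>tau \<beta> \<psi>. tau_norm \<alpha> \<phi> f \<le> K * tau_norm \<beta> \<psi> f) \<and>
      (\<forall>f\<in>tau \<beta> \<psi>. \<forall>x. (\<lambda>n. weyl_ext \<beta> \<psi> f n *\<^sub>C cesaro_sum \<beta> T n x) sums \<theta> f x)) \<and>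
    \<comment> \<open>(iv)\<close>
    (\<forall>a>0. onorm T \<le> a \<longrightarrow>
      (\<forall>f \<in> tau \<alpha> \<phi> \<inter> ell1 (\<lambda>n. a ^ n). \<forall>x. (\<lambda>n. f n *\<^sub>C (T ^^ n) x) sums \<theta> f x) \<and>
      (\<forall>z. a < norm z \<and> p_seq z \<in> tau \<alpha> \<phi> \<longrightarrow>
        \<theta> (p_seq z) \<circ> (\<lambda>x. z *\<^sub>C x - T x) = id \<and>
        (\<lambda>x. z *\<^sub>C x - T x) \<circ> \<theta> (p_seq z) = id))"
proof -
  interpret cesaro_bounded \<alpha> \<phi> T C
    using assms by unfold_locales auto
  define \<theta> where "\<theta> f = calculus (weyl_ext \<alpha> \<phi> f)" for f
  have \<theta>: "\<theta> (weyl_series \<alpha> a) = calculus a" if "a \<in> ell1 \<phi>" for a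
    using that by (simp add: \<theta>_def weyl_ext_weyl_series)
  have add: "(\<lambda>n. weyl_series \<alpha> a n + weyl_series \<alpha> b n) = weyl_series \<alpha> (\<lambda>n. a n + b n)"
    "(\<lambda>n. a n + b n) \<in> ell1 \<phi>" if "a \<in> ell1 \<phi>" "b \<in> ell1 \<phi>" for a b
    using that weyl_series_add[OF alpha_pos ell1_binom_k ell1_binom_k] weight_pos
    by (simp_all add: ell1_add less_imp_le)
  have cmult: "(\<lambda>n. c * weyl_series \<alpha> a n) = weyl_series \<alpha> (\<lambda>n. c * a n)"
    "(\<lambda>n. c * a n) \<in> ell1 \<phi>" if "a \<in> ell1 \<phi>" for a c
    using that weyl_series_cmult[OF alpha_pos ell1_binom_k] by (auto intro: ell1_cmult)
  note prod = conv_weyl_series weyl_prod_ell1[OF alpha_pos weight]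
  have hom: "bounded_algebra_hom (tau \<alpha> \<phi>) (tau_norm \<alpha> \<phi>) \<theta>"
    unfolding bounded_algebra_hom_def tau_eq ball_simps
  proof (intro conjI ballI allI exI)
    fix a assume a: "a \<in> ell1 \<phi>"
    show "bounded_clinear (\<theta> (weyl_series \<alpha> a))"
      using a by (simp add: \<theta> calculus_bounded_clinear)
    show "onorm (\<theta> (weyl_series \<alpha> a)) \<le> C * tau_norm \<alpha> \<phi> (weyl_series \<alpha> a)"
      using a by (simp add: \<theta> tau_norm_weyl_series onorm_calculus_le)
    show "(\<lambda>n. c * weyl_series \<alpha> a n) \<in> weyl_series \<alpha> ` ell1 \<phi>" for c
      using cmult[OF a] by simp
    show "\<theta> (\<lambda>n. c * weyl_series \<alpha> a n) = (\<lambda>x. c *\<^sub>C \<theta> (weyl_series \<alpha> a) x)" for c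
      using a cmult[OF a] by (simp add: \<theta> calculus_cmult fun_eq_iff)
    fix b assume b: "b \<in> ell1 \<phi>"
    show "(\<lambda>n. weyl_series \<alpha> a n + weyl_series \<alpha> b n) \<in> weyl_series \<alpha> ` ell1 \<phi>"
      using add[OF a b] by simp
    show "\<theta> (\<lambda>n. weyl_series \<alpha> a n + weyl_series \<alpha> b n) =
        (\<lambda>x. \<theta> (weyl_series \<alpha> a) x + \<theta> (weyl_series \<alpha> b) x)"
      using a b add[OF a b] by (simp add: \<theta> calculus_add fun_eq_iff)
    show "conv (weyl_series \<alpha> a) (weyl_series \<alpha> b) \<in> weyl_series \<alpha> ` ell1 \<phi>"
      using prod[OF a b] by simp
    show "\<theta> (conv (weyl_series \<alpha> a) (weyl_series \<alpha> b)) = \<theta> (weyl_series \<alpha> a) \<circ> \<theta> (weyl_series \<alpha> b)"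
      unfolding prod(1)[OF a b] \<theta>[OF a] \<theta>[OF b] \<theta>[OF prod(2)[OF a b]]
      by (simp add: calculus_weyl_prod[OF a b] fun_eq_iff)
  qed
  have series: "(\<lambda>n. weyl_ext \<alpha> \<phi> f n *\<^sub>C cesaro_sum \<alpha> T n x) sums \<theta> f x" if "f \<in> tau \<alpha> \<phi>" for f x
    using that by (auto simp: tau_eq \<theta> weyl_ext_weyl_series calculus_sums)
  have h: "cesaro_h \<alpha> n \<in> tau \<alpha> \<phi>" "\<theta> (cesaro_h \<alpha> n) = cesaro_sum \<alpha> T n" for n
    unfolding tau_eq cesaro_h_eq_weyl_series
    by (simp_all add: ell1_unit_seq \<theta> calculus_unit_seq)
  have "unit_seq 0 = cesaro_h \<alpha> 0"
    by (auto simp: unit_seq_def cesaro_h_eq fun_eq_iff)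
  then have "\<theta> (unit_seq 0) = cesaro_sum \<alpha> T 0"
    using h(2) by metis
  then have e0: "\<theta> (unit_seq 0) = id"
    by (simp add: fun_eq_iff cesaro_sum_0[OF alpha_pos])
  have "\<theta> (unit_seq 1) = \<theta> (\<lambda>n. cesaro_h \<alpha> 1 n + (- complex_of_real \<alpha>) * cesaro_h \<alpha> 0 n)"
    by (rule arg_cong[of _ _ \<theta>])
      (auto simp: unit_seq_def cesaro_h_eq fun_eq_iff binom_k_def le_Suc_eq)
  also have "\<dots> = (\<lambda>x. cesaro_sum \<alpha> T 1 x + (- complex_of_real \<alpha>) *\<^sub>C cesaro_sum \<alpha> T 0 x)"
    using hom h unfolding bounded_algebra_hom_def by metis
  also have "\<dots> = T"
    using cesaro_sum_Suc[OF alpha_pos T, of 0]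
    by (simp add: fun_eq_iff cesaro_sum_0[OF alpha_pos] binom_k_def scaleR_conv_scaleC[of \<alpha>]
        scaleC.minus_left)
  finally have e1: "\<theta> (unit_seq 1) = T" .
  have difference: "T (\<theta> (fdiff f) x) = (\<theta> f x - T (\<theta> f x)) - f 0 *\<^sub>C x"
    if f: "f \<in> tau \<alpha> \<phi>" "fdiff f \<in> tau \<alpha> \<phi>" for f x
  proof -
    obtain a b where ab: "a \<in> ell1 \<phi>" "b \<in> ell1 \<phi>" "f = weyl_series \<alpha> a" "fdiff f = weyl_series \<alpha> b"
      using f unfolding tau_eq by blast
    then show ?thesis
      using calculus_fdiff[OF ab(1,2) weyl_ext_fdiff[OF ab(1,2)]] \<theta> by metis
  qed
  have higher: "tau \<beta> \<psi> \<subseteq> tau \<alpha> \<phi> \<and>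
      (\<exists>K. \<forall>f\<in>tau \<beta> \<psi>. tau_norm \<alpha> \<phi> f \<le> K * tau_norm \<beta> \<psi> f) \<and>
      (\<forall>f\<in>tau \<beta> \<psi>. \<forall>x. (\<lambda>n. weyl_ext \<beta> \<psi> f n *\<^sub>C cesaro_sum \<beta> T n x) sums \<theta> f x)"
    if \<beta>: "\<alpha> < \<beta>" "\<psi> \<in> omega_loc \<beta>" and
      bdd: "bdd_above (range (\<lambda>n. conv (cesaro_k (\<beta> - \<alpha>)) \<phi> n / \<psi> n))" for \<beta> \<psi>
  proof -
    interpret higher: omega_weight \<beta> \<psi>
      using \<beta> alpha_pos by unfold_locales auto
    obtain M where le: "\<And>n. conv (cesaro_k (\<beta> - \<alpha>)) \<phi> n / \<psi> n \<le> M"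
      using bdd by (auto simp: bdd_above_def)
    have M: "conv (cesaro_k (\<beta> - \<alpha>)) \<phi> n \<le> M * \<psi> n" for n
      using le[of n] higher.weight_pos[of n] by (simp add: pos_divide_le_eq)
    have "f \<in> tau \<alpha> \<phi> \<and> tau_norm \<alpha> \<phi> f \<le> M * tau_norm \<beta> \<psi> f \<and>
        (\<forall>x. (\<lambda>n. weyl_ext \<beta> \<psi> f n *\<^sub>C cesaro_sum \<beta> T n x) sums \<theta> f x)" if "f \<in> tau \<beta> \<psi>" for f
    proof -
      obtain b where b: "b \<in> ell1 \<psi>" "f = weyl_series \<beta> b"
        using \<open>f \<in> tau \<beta> \<psi>\<close> unfolding higher.tau_eq by blast
      note high = calculus_higher_order[OF \<beta> b(1) M]
      have f: "f = weyl_series \<alpha> (weyl_series (\<beta> - \<alpha>) b)"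
        by (simp add: high(2) b(2))
      have "f \<in> tau \<alpha> \<phi>"
        unfolding f tau_eq using high(1) by blast
      moreover have "tau_norm \<alpha> \<phi> f \<le> M * tau_norm \<beta> \<psi> f"
        using high(3) tau_norm_weyl_series[OF high(1)] higher.tau_norm_weyl_series[OF b(1)]
        by (simp only: f[symmetric] b(2)[symmetric])
      moreover have "\<theta> f = calculus (weyl_series (\<beta> - \<alpha>) b)"
        unfolding f by (rule \<theta>[OF high(1)])
      moreover have "weyl_ext \<beta> \<psi> f = b"
        using higher.weyl_ext_weyl_series b by simp
      ultimately show ?thesis
        using high(4) by simp
    qed
    then show ?thesis
      by blast
  qed
  have power: "(\<lambda>n. f n *\<^sub>C (T ^^ n) x) sums \<theta> f x"
    if "0 < a" "onorm T \<le> a" "f \<in> tau \<alpha> \<phi>" "f \<in> ell1 (\<lambda>n. a ^ n)" for a f x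
  proof -
    obtain g where "g \<in> ell1 \<phi>" "f = weyl_series \<alpha> g"
      using \<open>f \<in> tau \<alpha> \<phi>\<close> unfolding tau_eq by blast
    then show ?thesis
      using calculus_power_series[OF that(1,2)] that(4) \<theta> by metis
  qed
  have resolvent: "\<theta> (p_seq z) \<circ> (\<lambda>x. z *\<^sub>C x - T x) = id \<and> (\<lambda>x. z *\<^sub>C x - T x) \<circ> \<theta> (p_seq z) = id"
    if "0 < a" "onorm T \<le> a" "a < norm z" "p_seq z \<in> tau \<alpha> \<phi>" for a z
  proof -
    have "0 < norm z"
      using that(1,3) by linarith
    then have "summable (\<lambda>n. (a / norm z) ^ n * (1 / norm z))"
      using that
      by (intro summable_mult2 summable_geometric) (simp add: pos_divide_less_eq)
    then have "p_seq z \<in> ell1 (\<lambda>n. a ^ n)"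
      by (simp add: ell1_def p_seq_def norm_divide norm_mult norm_power power_divide mult.commute)
    then show ?thesis
      using resolvent_power_series[OF T that(2,3) power[OF that(1,2,4)]] by blast
  qed
  show ?thesis
  proof (rule exI[of _ \<theta>], intro conjI)
    show "\<forall>a>0. onorm T \<le> a \<longrightarrow>
      (\<forall>f \<in> tau \<alpha> \<phi> \<inter> ell1 (\<lambda>n. a ^ n). \<forall>x. (\<lambda>n. f n *\<^sub>C (T ^^ n) x) sums \<theta> f x) \<and>
      (\<forall>z. a < norm z \<and> p_seq z \<in> tau \<alpha> \<phi> \<longrightarrow>
        \<theta> (p_seq z) \<circ> (\<lambda>x. z *\<^sub>C x - T x) = id \<and>
        (\<lambda>x. z *\<^sub>C x - T x) \<circ> \<theta> (p_seq z) = id)"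
      by (intro allI impI conjI ballI) (use power resolvent in auto)
  qed (use hom series h e0 e1 difference higher in simp_all)
qed

end
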